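(* Let $G$ be a finite simple graph without isolated vertices, with edge set $E(G)$. For each vertex $v$ let $d_v$ be the degree of $v$ in $G$. Let $\lambda > 0$ be real. Then \[ P_G(\lambda) \le \prod_{uv \in E(G)} P_{K_{d_v,d_u}}(\lambda)^{1/(d_u d_v)} = \prod_{uv \in E(G)} \left((1+\lambda)^{d_u} + (1+\lambda)^{d_v} - 1\right)^{1/(d_u d_v)}. \] Equality in the inequality holds if and only if $G$ is a disjoint union of complete bipartite graphs.
   Context: All graphs are finite and simple (undirected). An isolated vertex is a vertex of degree $0$. For a graph $G$, $\mathcal{I}(G)$ denotes the set of independent sets of $G$ (including the empty set), and the independent set polynomial is $P_G(\lambda) = \sum_{I \in \mathcal{I}(G)} \lambda^{|I|}$. $K_{a,b}$ denotes the complete bipartite graph with parts of sizes $a,b \ge 1$. In a disjoint union of complete bipartite graphs, the components may be $K_{a,b}$ with different values of $a,b\ge 1$. The product is over all (unordered) edges $uv$ of $G$. *)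

theory Defs
  imports Complex_Main "Graph_Theory.Graph_Theory"
begin

text \<open>
  A finite simple undirected graph is an instance of the locale \<^locale>\<open>graph\<close>: a finite symmetric
  digraph without loops and parallel arcs. An undirected edge \<open>uv\<close> thus corresponds to the two
  arcs from \<open>u\<close> to \<open>v\<close> and from \<open>v\<close> to \<open>u\<close>, and is represented below by the two-element set
  \<open>{u, v}\<close>, so that it is counted once.
\<close>

definition edges :: "('a, 'b) pre_digraph \<Rightarrow> 'a set set" where
  "edges G = {{u, v} |u v. u \<rightarrow>\<^bsub>G\<^esub> v}"

text \<open>In a \<^locale>\<open>graph\<close>, the arcs leaving \<open>v\<close> correspond bijectively to the neighbours of \<open>v\<close>.\<close>

abbreviation deg :: "('a, 'b) pre_digraph \<Rightarrow> 'a \<Rightarrow> nat" where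
  "deg G v \<equiv> out_degree G v"

definition no_isolated_verts :: "('a, 'b) pre_digraph \<Rightarrow> bool" where
  "no_isolated_verts G \<longleftrightarrow> (\<forall>v\<in>verts G. deg G v \<noteq> 0)"

definition indep_sets :: "('a, 'b) pre_digraph \<Rightarrow> 'a set set" where
  "indep_sets G = {I. I \<subseteq> verts G \<and> (\<forall>u\<in>I. \<forall>v\<in>I. \<not> u \<rightarrow>\<^bsub>G\<^esub> v)}"

definition indep_poly :: "('a, 'b) pre_digraph \<Rightarrow> real \<Rightarrow> real" where
  "indep_poly G x = (\<Sum>I\<in>indep_sets G. x ^ card I)"

text \<open>
  The product of \<open>f u v\<close> over all unordered edges \<open>uv\<close>. The orientation of an edge is chosen
  arbitrarily, so this is meaningful for functions that are symmetric on adjacent vertices.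
\<close>

definition prod_edges :: "('a, 'b) pre_digraph \<Rightarrow> ('a \<Rightarrow> 'a \<Rightarrow> real) \<Rightarrow> real" where
  "prod_edges G f = (\<Prod>e\<in>edges G. let p = (SOME p. e = {fst p, snd p}) in f (fst p) (snd p))"

lemma prod_edges_factor:
  assumes "f u v = f v u"
  shows "(let p = (SOME p. {u, v} = {fst p, snd p}) in f (fst p) (snd p)) = f u v"
proof -
  define p where "p = (SOME p. {u, v} = {fst p, snd p})"
  have "{u, v} = {fst p, snd p}"
    unfolding p_def by (rule someI[of _ "(u, v)"]) simp
  then show ?thesis
    using assms unfolding p_def[symmetric] Let_def by (auto simp: doubleton_eq_iff)
qed

text \<open>
  A concrete complete bipartite graph; the library provides the predicate
  \<^const>\<open>complete_bipartite_digraph\<close>, written \<open>K\<^bsub>a,b\<^esub>\<close>.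
\<close>

definition complete_bipartite :: "nat \<Rightarrow> nat \<Rightarrow> (nat + nat, (nat + nat) \<times> (nat + nat)) pre_digraph" where
  "complete_bipartite a b =
     (let U = Inl ` {..<a}; V = Inr ` {..<b}
      in with_proj \<lparr> pverts = U \<union> V, parcs = U \<times> V \<union> V \<times> U \<rparr>)"

lemma complete_bipartite_K: "K\<^bsub>a,b\<^esub> (complete_bipartite a b)"
  unfolding complete_bipartite_def Let_def complete_bipartite_digraph_pair_def
  by (intro conjI exI[of _ "Inl ` {..<a}"] exI[of _ "Inr ` {..<b}"]) (auto simp: card_image)

text \<open>\<open>pre_digraph.Union G Hs\<close> takes its end-point maps from \<open>G\<close>; \<open>subgraph H G\<close> makes those of \<open>H\<close> agree.\<close>

definition disjoint_union_of :: "('a, 'b) pre_digraph \<Rightarrow> ('a, 'b) pre_digraph set \<Rightarrow> bool" where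
  "disjoint_union_of G Hs \<longleftrightarrow>
     (\<forall>H\<in>Hs. subgraph H G) \<and>
     (\<forall>H\<in>Hs. \<forall>H'\<in>Hs. H \<noteq> H' \<longrightarrow> verts H \<inter> verts H' = {}) \<and>
     G = pre_digraph.Union G Hs"

definition disjoint_union_of_complete_bipartite :: "('a, 'b) pre_digraph \<Rightarrow> bool" where
  "disjoint_union_of_complete_bipartite G \<longleftrightarrow>
     (\<exists>Hs. disjoint_union_of G Hs \<and> (\<forall>H\<in>Hs. \<exists>a b. 1 \<le> a \<and> 1 \<le> b \<and> K\<^bsub>a,b\<^esub> H))"

end

theory Submission
  imports Defs
begin

text \<open>
  Let \<open>t = 1 / (1 + \<lambda>)\<close> and let each vertex be chosen independently with probability
  \<open>1 - t = \<lambda> / (1 + \<lambda>)\<close>. Then \<open>P\<^sub>G(\<lambda>) / (1 + \<lambda>) ^ n\<close> is the probability that the chosen set is independent.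
  For the complete bipartite graph with parts of sizes \<open>a\<close> and \<open>b\<close> this probability is
  \<open>r(a, b) = t ^ a + t ^ b - t ^ (a + b)\<close>. Without isolated vertices, every vertex receives total
  weight 1 from the numbers \<open>1 / d\<^sub>u\<close> at its edges, so the powers of \<open>1 + \<lambda>\<close> cancel, and the claim is
  that the probability is at most the product of \<open>r(d\<^sub>u, d\<^sub>v)\<close> to the power \<open>1 / (d\<^sub>u d\<^sub>v)\<close> over the edges.

  Bipartite case. Write the graph as a relation \<open>R\<close> between \<open>A\<close> and \<open>B\<close>, and remove a vertex \<open>w\<close> of
  largest degree \<open>a\<close> from \<open>A\<close>. If \<open>w\<close> is not chosen, \<open>w\<close> is deleted; if it is chosen, its neighbours
  are deleted as well. In the second event the vertices of \<open>A\<close> have lost neighbours, but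
  the bound is proved for arbitrary positive numbers \<open>d u\<close> that are at least the degrees of the
  \<open>u \<in> A\<close>, so these numbers can be kept. The induction hypothesis bounds both events by products over the vertices
  of \<open>B\<close>. Each neighbour of \<open>w\<close> contributes one factor in each event, there are at most \<open>a\<close> neighbours,
  and Hoelder's inequality with weights \<open>1 / a\<close> reduces the claim to a single neighbour \<open>v\<close>
  (\<open>vertex_removal_step\<close>). There, Hoelder's inequality over the other neighbours \<open>u\<close> of \<open>v\<close> reduces it
  to one inequality between numbers (\<open>local_inequality\<close>), which needs \<open>d u \<le> a\<close>; this is why \<open>w\<close> has
  the largest degree.

  Equality in the bipartite case. The numerical inequality is strict unless \<open>d u = a\<close>, and equality in
  the first use of Hoelder's inequality forces all neighbours of \<open>w\<close> to have the same degree. This holds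
  for every \<open>w\<close> of largest degree, and the graph without \<open>w\<close> again attains its bound. By induction
  the relation is closed under walks of length three: \<open>R x y\<close>, \<open>R x' y\<close>, \<open>R x' y'\<close> imply \<open>R x y'\<close>
  (\<open>bip_indep_prob_eq_imp_closed\<close>).

  General case. The square of \<open>P\<^sub>G\<close> is at most the independence polynomial of the bipartite double cover
  of \<open>G\<close> (\<open>indep_poly_on_square_le\<close>), whose bound is the square of the bound for \<open>G\<close>. If \<open>G\<close> attains its
  bound, so does the double cover, and then the adjacency relation of \<open>G\<close> itself is closed under
  walks of length three. For simple graphs this closure property means that every component
  is complete bipartite: a triangle, or any odd cycle, would produce a loop. Conversely, for
  such graphs both sides are multiplicative over components, and every component attains equality.
\<close>

section \<open>Hoelder's inequality for finite expectations\<close>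

text \<open>
  The concavity of the logarithm at the weighted mean. The missing weight \<open>1 - sum \<theta> I\<close> is put on an
  additional value 1. In the application the weights are \<open>1 / a\<close>, one for each neighbour of
  a vertex whose nominal degree \<open>a\<close> may exceed the number of its neighbours.
\<close>

lemma weighted_am_gm_slack:
  fixes z \<theta> :: "'i \<Rightarrow> real"
  assumes fin: "finite I" and z: "\<And>i. i \<in> I \<Longrightarrow> z i > 0" and \<theta>: "\<And>i. i \<in> I \<Longrightarrow> \<theta> i \<ge> 0"
    and le1: "sum \<theta> I \<le> 1"
  shows "(\<Prod>i\<in>I. z i powr \<theta> i) \<le> 1 + (\<Sum>i\<in>I. \<theta> i * (z i - 1))"
    and "(\<Prod>i\<in>I. z i powr \<theta> i) = 1 + (\<Sum>i\<in>I. \<theta> i * (z i - 1)) \<Longrightarrow>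
          i \<in> I \<Longrightarrow> \<theta> i > 0 \<Longrightarrow> z i = 1 + (\<Sum>i\<in>I. \<theta> i * (z i - 1))"
proof -
  define M where "M = 1 + (\<Sum>i\<in>I. \<theta> i * (z i - 1))"
  have M_eq: "M = (1 - sum \<theta> I) + (\<Sum>i\<in>I. \<theta> i * z i)"
    by (simp add: M_def algebra_simps sum_subtractf)
  have nn: "(\<Sum>i\<in>I. \<theta> i * z i) \<ge> 0"
    using z \<theta> by (intro sum_nonneg mult_nonneg_nonneg) (auto intro: less_imp_le)
  have M: "M > 0"
  proof (cases "sum \<theta> I = 1")
    case True
    then obtain i where i: "i \<in> I" "\<theta> i \<noteq> 0" using sum.neutral[of I \<theta>] by (metis zero_neq_one)
    have "(\<Sum>i\<in>I. \<theta> i * z i) > 0"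
      using z \<theta> fin i by (intro sum_pos2[of I i]) (auto intro!: mult_pos_pos simp: less_le)
    then show ?thesis using le1 M_eq by linarith
  next
    case False then show ?thesis using le1 M_eq nn by linarith
  qed
  define g where "g i = \<theta> i * (z i / M - 1 - ln (z i / M))" for i
  have g: "g i \<ge> 0" if "i \<in> I" for i
    unfolding g_def using ln_le_minus_one[of "z i / M"] z[OF that] \<theta>[OF that] M by simp
  \<comment> \<open>the contribution of the additional value 1\<close>
  have slack: "(1 - sum \<theta> I) * (1 / M - 1 - ln (1 / M)) \<ge> 0"
    using ln_le_minus_one[of "1 / M"] M le1 by simp
  define P where "P = (\<Prod>i\<in>I. z i powr \<theta> i)"
  have P: "P > 0" unfolding P_def using z by (force intro!: prod_pos)
  have lnP: "ln P = (\<Sum>i\<in>I. \<theta> i * ln (z i))"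
    unfolding P_def using fin z by (subst ln_prod) (force simp: ln_powr intro!: sum.cong)+
  have "sum g I + (1 - sum \<theta> I) * (1 / M - 1 - ln (1 / M)) =
     (\<Sum>i\<in>I. \<theta> i * z i / M - \<theta> i - \<theta> i * ln (z i) + \<theta> i * ln M)
        + (1 - sum \<theta> I) * (1 / M - 1 + ln M)"
    unfolding g_def using z M by (intro arg_cong2[of _ _ _ _ "(+)"] sum.cong)
       (fastforce simp: ln_div algebra_simps)+
  also have "\<dots> = (\<Sum>i\<in>I. \<theta> i * z i) / M - sum \<theta> I - ln P + sum \<theta> I * ln M
        + (1 - sum \<theta> I) * (1 / M - 1 + ln M)"
    by (simp add: sum.distrib sum_subtractf lnP sum_divide_distrib sum_distrib_right)
  also have "\<dots> = M / M - 1 + ln M - ln P"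
    by (subst (3) M_eq) (simp add: algebra_simps add_divide_distrib diff_divide_distrib)
  finally have key: "sum g I + (1 - sum \<theta> I) * (1 / M - 1 - ln (1 / M)) = ln M - ln P"
    using M by simp
  have "sum g I \<ge> 0" using g by (rule sum_nonneg)
  with key slack have "ln P \<le> ln M" by linarith
  then show "(\<Prod>i\<in>I. z i powr \<theta> i) \<le> 1 + (\<Sum>i\<in>I. \<theta> i * (z i - 1))"
    using P M by (simp add: P_def M_def)
  assume eq: "(\<Prod>i\<in>I. z i powr \<theta> i) = 1 + (\<Sum>i\<in>I. \<theta> i * (z i - 1))"
    and i: "i \<in> I" "\<theta> i > 0"
  then have "sum g I = 0"
    using key slack \<open>sum g I \<ge> 0\<close> by (simp add: P_def M_def)
  then have "g i = 0" using i fin g by (simp add: sum_nonneg_eq_0_iff)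
  then have "ln (z i / M) = z i / M - 1" using i by (simp add: g_def)
  then have "z i / M = 1" using ln_eq_minus_one[of "z i / M"] z[OF i(1)] M by simp
  then show "z i = 1 + (\<Sum>i\<in>I. \<theta> i * (z i - 1))" using M by (simp add: M_def)
qed

text \<open>
  After division by the means \<open>\<Sum>k\<in>K. w k * f i k\<close>, Hoelder's inequality is the expectation of
  the weighted inequality of means at each point \<open>k\<close>. Equality of the expectations forces equality at each
  point, so that the normalised functions with positive weight all agree.
\<close>

lemma holder_finite_expectation:
  fixes w :: "'k \<Rightarrow> real" and f :: "'i \<Rightarrow> 'k \<Rightarrow> real" and \<theta> :: "'i \<Rightarrow> real"
  assumes fin: "finite K" "finite I"
    and w: "\<And>k. k \<in> K \<Longrightarrow> w k > 0" "sum w K = 1"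
    and f: "\<And>i k. i \<in> I \<Longrightarrow> k \<in> K \<Longrightarrow> f i k > 0"
    and \<theta>: "\<And>i. i \<in> I \<Longrightarrow> \<theta> i \<ge> 0" "sum \<theta> I \<le> 1"
  shows "(\<Sum>k\<in>K. w k * (\<Prod>i\<in>I. f i k powr \<theta> i)) \<le> (\<Prod>i\<in>I. (\<Sum>k\<in>K. w k * f i k) powr \<theta> i)"
      (is "?L \<le> ?R")
    and "\<lbrakk>(\<Sum>k\<in>K. w k * (\<Prod>i\<in>I. f i k powr \<theta> i)) = (\<Prod>i\<in>I. (\<Sum>k\<in>K. w k * f i k) powr \<theta> i);
          i \<in> I; j \<in> I; k \<in> K; \<theta> i > 0; \<theta> j > 0\<rbrakk>
          \<Longrightarrow> f i k * (\<Sum>k\<in>K. w k * f j k) = f j k * (\<Sum>k\<in>K. w k * f i k)"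
proof -
  define M where "M i = (\<Sum>k\<in>K. w k * f i k)" for i
  have "K \<noteq> {}" using w(2) by auto
  then have M: "M i > 0" if "i \<in> I" for i
    unfolding M_def using fin w f that by (intro sum_pos mult_pos_pos) auto
  have R: "?R > 0" using M fin by (force intro!: prod_pos simp: M_def)
  define G where "G k = (\<Prod>i\<in>I. (f i k / M i) powr \<theta> i)" for k
  define H where "H k = 1 + (\<Sum>i\<in>I. \<theta> i * (f i k / M i - 1))" for k
  have GH: "G k \<le> H k" if "k \<in> K" for k
    unfolding G_def H_def using fin \<theta> f M that by (intro weighted_am_gm_slack) auto
  have "(\<Sum>k\<in>K. w k * (f i k / M i - 1)) = 0" if "i \<in> I" for i
  proof -
    have "(\<Sum>k\<in>K. w k * (f i k / M i - 1)) = (\<Sum>k\<in>K. w k * f i k) / M i - sum w K"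
      by (simp add: algebra_simps sum_subtractf sum_divide_distrib)
    then show ?thesis using M[OF that] w by (simp flip: M_def)
  qed
  then have "(\<Sum>i\<in>I. \<theta> i * (\<Sum>k\<in>K. w k * (f i k / M i - 1))) = 0" by simp
  then have "(\<Sum>k\<in>K. \<Sum>i\<in>I. w k * (\<theta> i * (f i k / M i - 1))) = 0"
    by (subst sum.swap) (simp add: sum_distrib_left mult.left_commute)
  then have H1: "(\<Sum>k\<in>K. w k * H k) = 1"
    by (simp add: H_def distrib_left sum.distrib w sum_distrib_left)
  have G_eq: "G k = (\<Prod>i\<in>I. f i k powr \<theta> i) / ?R" if "k \<in> K" for k
  proof -
    have "G k = (\<Prod>i\<in>I. f i k powr \<theta> i / M i powr \<theta> i)"
      unfolding G_def using f M that by (intro prod.cong) (auto simp: powr_divide less_imp_le)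
    then show ?thesis by (simp add: prod_dividef M_def)
  qed
  have L: "?L = (\<Sum>k\<in>K. w k * G k) * ?R"
    unfolding sum_distrib_right using R by (intro sum.cong) (auto simp: G_eq)
  have le: "(\<Sum>k\<in>K. w k * G k) \<le> (\<Sum>k\<in>K. w k * H k)"
    using GH w by (intro sum_mono mult_left_mono) (auto intro: less_imp_le)
  then show "?L \<le> ?R" unfolding L using H1 R by simp
  assume eq: "?L = ?R" and ij: "i \<in> I" "j \<in> I" "k \<in> K" "\<theta> i > 0" "\<theta> j > 0"
  have "(\<Sum>k\<in>K. w k * G k) = 1" using eq L R by simp
  then have "(\<Sum>k\<in>K. w k * (H k - G k)) = 0"
    using H1 by (simp add: right_diff_distrib sum_subtractf)
  then have "w k * (H k - G k) = 0"
    using ij fin GH w by (subst (asm) sum_nonneg_eq_0_iff) (auto intro!: mult_nonneg_nonneg intro: less_imp_le)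
  then have "G k = H k" using w ij by force
  then have "f l k / M l = H k" if "l \<in> I" "\<theta> l > 0" for l
    unfolding G_def H_def using fin \<theta> f M ij that
    by (intro weighted_am_gm_slack(2)[of I "\<lambda>i. f i k / M i" \<theta>]) auto
  then have "f i k / M i = f j k / M j" using ij by simp
  then show "f i k * (\<Sum>k\<in>K. w k * f j k) = f j k * (\<Sum>k\<in>K. w k * f i k)"
    using M[of i] M[of j] ij by (simp add: field_simps flip: M_def)
qed

text \<open>
  The form for a single random choice: a vertex is left out with probability \<open>p\<close> or chosen
  with probability \<open>1 - p\<close>.
\<close>

lemma holder_two_point:
  fixes x y \<theta> :: "'i \<Rightarrow> real" and p :: real
  assumes fin: "finite I" and p: "0 < p" "p < 1"
    and xy: "\<And>i. i \<in> I \<Longrightarrow> x i > 0" "\<And>i. i \<in> I \<Longrightarrow> y i > 0"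
    and \<theta>: "\<And>i. i \<in> I \<Longrightarrow> \<theta> i \<ge> 0" "sum \<theta> I \<le> 1"
  shows "p * (\<Prod>i\<in>I. x i powr \<theta> i) + (1 - p) * (\<Prod>i\<in>I. y i powr \<theta> i)
           \<le> (\<Prod>i\<in>I. (p * x i + (1 - p) * y i) powr \<theta> i)"
    and "\<lbrakk>p * (\<Prod>i\<in>I. x i powr \<theta> i) + (1 - p) * (\<Prod>i\<in>I. y i powr \<theta> i)
           = (\<Prod>i\<in>I. (p * x i + (1 - p) * y i) powr \<theta> i);
          i \<in> I; j \<in> I; \<theta> i > 0; \<theta> j > 0\<rbrakk> \<Longrightarrow> x i * y j = x j * y i"
proof -
  define w where "w b = (if b then p else 1 - p)" for b
  define f where "f i b = (if b then x i else y i)" for i b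
  note holder = holder_finite_expectation[of UNIV I w f \<theta>]
  have f: "f i b > 0" if "i \<in> I" for i b using xy that by (simp add: f_def)
  have w: "w b > 0" for b using p by (simp add: w_def)
  have sw: "sum w UNIV = 1" by (simp add: UNIV_bool w_def)
  show "p * (\<Prod>i\<in>I. x i powr \<theta> i) + (1 - p) * (\<Prod>i\<in>I. y i powr \<theta> i)
           \<le> (\<Prod>i\<in>I. (p * x i + (1 - p) * y i) powr \<theta> i)"
    using holder(1)[OF _ fin w sw f \<theta>] by (simp add: UNIV_bool w_def f_def add.commute)
  assume eq: "p * (\<Prod>i\<in>I. x i powr \<theta> i) + (1 - p) * (\<Prod>i\<in>I. y i powr \<theta> i)
           = (\<Prod>i\<in>I. (p * x i + (1 - p) * y i) powr \<theta> i)"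
    and ij: "i \<in> I" "j \<in> I" "\<theta> i > 0" "\<theta> j > 0"
  define M where "M i = p * x i + (1 - p) * y i" for i
  have "f i k * M j = f j k * M i" for k
    using holder(2)[OF _ fin w sw f \<theta>, of i j k] eq ij
    by (simp add: UNIV_bool w_def f_def M_def add.commute)
  from this[of True] this[of False] have "x i * M j = x j * M i" "y i * M j = y j * M i"
    by (simp_all add: f_def)
  then have "(x i * y j) * M i = (x j * y i) * M i"
    by (metis mult.commute mult.left_commute)
  moreover have "M i > 0" using p xy ij by (simp add: M_def add_pos_pos)
  ultimately show "x i * y j = x j * y i" by simp
qed

section \<open>The inequality for one edge\<close>

text \<open>
  The probability that a random vertex set of the complete bipartite graph with parts of sizes \<open>a\<close> and
  \<open>b\<close> is independent, if each vertex is left out with probability \<open>t\<close>: one of the two parts must be left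
  out completely.
\<close>

definition bip_density :: "real \<Rightarrow> nat \<Rightarrow> nat \<Rightarrow> real" where
  "bip_density t a b = t ^ a + t ^ b - t ^ (a + b)"

lemma bip_density_0 [simp]: "bip_density t a 0 = 1"
  by (simp add: bip_density_def)

lemma bip_density_alt: "bip_density t a b = t ^ a + (1 - t ^ a) * t ^ b"
  by (simp add: bip_density_def algebra_simps power_add)

lemma bip_density_pos:
  assumes "0 < t" "t < 1" shows "bip_density t a b > 0"
proof -
  have "t ^ a > 0" "t ^ a \<le> 1" "t ^ b > 0"
    using assms by (auto intro: power_le_one)
  then show ?thesis by (simp add: bip_density_alt add_pos_nonneg)
qed

lemma bip_density_eq_iff:
  assumes t: "0 < t" "t < 1" and a: "a > 0"
  shows "bip_density t a b = bip_density t a b' \<longleftrightarrow> b = b'"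
proof -
  have "t ^ a < 1" using t a by (simp add: power_less_one_iff)
  then show ?thesis
    using power_inject_exp'[of t b b'] t by (auto simp: bip_density_alt)
qed

lemma powr_of_power:
  assumes "x > (0::real)" shows "(x ^ n) powr y = x powr (real n * y)"
  using assms by (simp add: powr_powr flip: powr_realpow)

lemma powr_inj_base:
  fixes u v s :: real
  assumes "u powr s = v powr s" "u > 0" "v > 0" "s \<noteq> 0"
  shows "u = v"
  using arg_cong[OF assms(1), of "\<lambda>z. z powr (1 / s)"] assms(2-) by (simp add: powr_powr)

text \<open>
  Think of \<open>T0 = bip_density t b e\<close> and \<open>T1 = t ^ b\<close> as the values of a random variable \<open>T\<close> on the two
  states of a vertex \<open>w\<close>, left out with probability \<open>t\<close> or chosen with probability \<open>1 - t\<close>, where \<open>w\<close> is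
  joined to the \<open>b\<close> vertices on one side of a complete bipartite graph with \<open>e\<close> vertices on the other
  side. The left-hand side \<open>L\<close> is the expectation of \<open>T powr s\<close>, and \<open>L\<close> is also the expectation of \<open>\<phi> * T\<close> for
  \<open>\<phi> = T powr (s - 1)\<close>. As \<open>T\<close> is itself an expectation over the \<open>b\<close> vertices, a first use of
  Hoelder's inequality over these, with weights \<open>1 / d\<close> and \<open>e / d\<close> for \<open>d = e + 1\<close>, splits off the factor
  \<open>bip_density t b d powr (e / d)\<close>. The other factor is the \<open>d\<close>-th root of an average of
  \<open>d\<close>-th powers of expectations; expanded over \<open>d\<close> independent copies of \<open>w\<close>, the average is bounded by a second use with weights \<open>1 - 1 / s\<close> and \<open>1 / s\<close>. That
  gives \<open>bip_density t a d\<close> and a power of \<open>L\<close>, which is cancelled.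

  Equality in the first use forces \<open>\<phi>\<close> to be constant. Since \<open>T0 > T1\<close>, this happens only for \<open>s = 1\<close>.
\<close>

lemma local_inequality:
  fixes t :: real and a b e :: nat
  assumes t: "0 < t" "t < 1" and ba: "1 \<le> b" "b \<le> a" and e: "1 \<le> e"
  defines "s \<equiv> real a / real b"
  shows "t * bip_density t b e powr s + (1 - t) * t ^ a
           \<le> bip_density t a (e + 1) powr (1 / real (e + 1))
             * bip_density t b (e + 1) powr (s * (real e / real (e + 1)))" (is "?L \<le> ?R")
    and "t * bip_density t b e powr s + (1 - t) * t ^ a
           = bip_density t a (e + 1) powr (1 / real (e + 1))
             * bip_density t b (e + 1) powr (s * (real e / real (e + 1))) \<Longrightarrow> b = a"
proof -
  define d where "d = e + 1"
  define \<beta> where "\<beta> = t ^ b"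
  define T0 where "T0 = bip_density t b e"
  define \<phi>0 \<phi>1 where "\<phi>0 = T0 powr (s - 1)" and "\<phi>1 = \<beta> powr (s - 1)"
  define L where "L = ?L"
  define X Y where "X = (t * \<phi>0 + (1 - t) * \<phi>1) ^ d" and "Y = (t * \<phi>0) ^ d"
  have s: "s \<ge> 1" using ba by (simp add: s_def)
  have \<beta>: "0 < \<beta>" "\<beta> < 1" using t ba by (auto simp: \<beta>_def power_less_one_iff)
  have T0: "T0 = \<beta> + (1 - \<beta>) * t ^ e" by (simp add: T0_def \<beta>_def bip_density_alt)
  have "(1 - \<beta>) * t ^ e > 0" using \<beta> t by simp
  then have T0\<beta>: "T0 > \<beta>" by (simp add: T0)
  then have T0_pos: "T0 > 0" using \<beta> by linarith
  have \<phi>: "\<phi>0 > 0" "\<phi>1 > 0" using \<beta> T0_pos by (auto simp: \<phi>0_def \<phi>1_def)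
  have \<beta>s: "\<beta> powr s = t ^ a"
    unfolding \<beta>_def using t ba by (subst powr_of_power) (auto simp: s_def powr_realpow)
  have T0s: "T0 powr s = T0 * \<phi>0" and \<beta>s': "t ^ a = \<beta> * \<phi>1"
    using T0_pos \<beta> by (auto simp: \<phi>0_def \<phi>1_def powr_diff simp flip: \<beta>s)
  have X: "X > 0" and Y: "Y > 0" using \<phi> t by (auto simp: X_def Y_def intro!: zero_less_power add_pos_pos)
  have d: "d > 0" "real d > 0" by (auto simp: d_def)
  have L_pos: "L > 0" unfolding L_def using t by (intro add_nonneg_pos) auto
  have L_eq: "L = \<beta> * (t * \<phi>0 + (1 - t) * \<phi>1) + (1 - \<beta>) * (t * \<phi>0 * t ^ e)"
    unfolding L_def T0_def[symmetric] T0s \<beta>s' by (simp add: T0 algebra_simps)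
  have sum_theta: "1 / real d + real e / real d = 1"
    using d by (simp add: d_def field_simps)
  have root_X: "X powr (1 / real d) = t * \<phi>0 + (1 - t) * \<phi>1"
    and root_Y: "Y powr (1 / real d) = t * \<phi>0"
    and root_t: "(t ^ d) powr (real e / real d) = t ^ e"
    unfolding X_def Y_def using \<phi> t d
    by (subst powr_of_power; simp add: add_pos_pos powr_realpow)+
  have dens_b: "\<beta> * 1 + (1 - \<beta>) * t ^ d = bip_density t b d"
    by (simp add: bip_density_alt \<beta>_def)
  (* First use, over the b vertices: with probability \<beta> none of them is chosen, and then w is
     unrestricted and the e vertices are too. Otherwise w and the e vertices must be left out. *)
  define x y \<theta> where "x = (\<lambda>i. if i then X else 1)"
    and "y = (\<lambda>i. if i then Y else t ^ d)"
    and "\<theta> = (\<lambda>i. if i then 1 / real d else real e / real d)"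
  note holder1 = holder_two_point[of "UNIV :: bool set" \<beta> x y \<theta>]
  have xy: "x i > 0" "y i > 0" "\<theta> i \<ge> 0" for i
    using X Y t by (auto simp: x_def y_def \<theta>_def)
  have theta: "sum \<theta> UNIV \<le> 1" using sum_theta by (simp add: UNIV_bool \<theta>_def add.commute)
  have lhs1: "\<beta> * (\<Prod>i\<in>UNIV. x i powr \<theta> i) + (1 - \<beta>) * (\<Prod>i\<in>UNIV. y i powr \<theta> i) = L"
    unfolding L_eq by (simp add: UNIV_bool x_def y_def \<theta>_def root_X root_Y root_t)
  have rhs1: "(\<Prod>i\<in>UNIV. (\<beta> * x i + (1 - \<beta>) * y i) powr \<theta> i)
      = (\<beta> * X + (1 - \<beta>) * Y) powr (1 / real d) * bip_density t b d powr (real e / real d)"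
    using dens_b by (simp add: UNIV_bool x_def y_def \<theta>_def)
  have step1: "L \<le> (\<beta> * X + (1 - \<beta>) * Y) powr (1 / real d)
                       * bip_density t b d powr (real e / real d)"
    using holder1(1)[OF _ \<beta> xy theta] unfolding lhs1 rhs1 by simp
  (* Second use, over the number k of chosen vertices among d independent copies of w: the b
     vertices are unrestricted for k = 0 and must all be left out, with probability \<beta>, otherwise. *)
  define w where "w k = real (d choose k) * (1 - t) ^ k * t ^ (d - k)" for k
  define f where "f i k = (if i then (\<beta> powr s) ^ k * (T0 powr s) ^ (d - k)
                            else (if k = 0 then 1 else t ^ a))" for i and k :: nat
  define \<eta> where "\<eta> i = (if i then 1 - 1 / s else 1 / s)" for i
  note holder2 = holder_finite_expectation(1)[of "{..d}" "UNIV :: bool set" w f \<eta>]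
  have w: "w k > 0" if "k \<in> {..d}" for k using that t by (simp add: w_def)
  have sw: "sum w {..d} = 1"
    using binomial_ring[of "1 - t" t d] by (simp add: w_def)
  have f: "f i k > 0" for i k using t T0_pos \<beta> by (auto simp: f_def)
  have \<eta>: "\<eta> i \<ge> 0" "sum \<eta> UNIV \<le> 1" for i
    using s by (auto simp: \<eta>_def UNIV_bool)
  have atMost_d: "{..d} = insert 0 {Suc 0..d}" by auto
  have w0: "w 0 = t ^ d" by (simp add: w_def)
  have sw1: "sum w {Suc 0..d} = 1 - t ^ d"
    using sw w0 by (simp add: atMost_d)
  have M_True: "(\<Sum>k\<le>d. w k * f True k) = L ^ d"
  proof -
    have "L ^ d = ((1 - t) * \<beta> powr s + t * T0 powr s) ^ d"
      unfolding L_def by (simp add: T0_def \<beta>s add.commute)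
    then show ?thesis
      by (simp add: binomial_ring w_def f_def power_mult_distrib mult_ac)
  qed
  have M_False: "(\<Sum>k\<le>d. w k * f False k) = bip_density t a d"
  proof -
    have "(\<Sum>k\<le>d. w k * f False k) = w 0 + sum w {Suc 0..d} * t ^ a"
      unfolding atMost_d by (simp add: f_def sum_distrib_right)
    then show ?thesis by (simp add: w0 sw1 bip_density_def algebra_simps power_add)
  qed
  have pow_powr: "((x powr s) ^ m) powr (1 - 1 / s) = (x powr (s - 1)) ^ m" if "x > 0" for x m
  proof -
    have "((x powr s) ^ m) powr (1 - 1 / s) = x powr (s * (real m * (1 - 1 / s)))"
      using that by (subst powr_of_power) (auto simp: powr_powr)
    also have "s * (real m * (1 - 1 / s)) = (s - 1) * real m" using s by (simp add: field_simps)
    also have "x powr \<dots> = (x powr (s - 1)) ^ m"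
      using that by (subst powr_powr[symmetric]) (simp add: powr_realpow)
    finally show ?thesis .
  qed
  have root_a: "(t ^ a) powr (1 / s) = \<beta>"
    using \<beta> s by (simp add: powr_powr flip: \<beta>s)
  have "(\<Sum>k\<le>d. w k * (\<Prod>i\<in>UNIV. f i k powr \<eta> i))
      = (\<Sum>k\<le>d. w k * (\<phi>1 ^ k * \<phi>0 ^ (d - k)) * (if k = 0 then 1 else \<beta>))"
    using \<beta> T0_pos
    by (intro sum.cong) (auto simp: UNIV_bool f_def \<eta>_def powr_mult pow_powr root_a \<phi>0_def \<phi>1_def)
  also have "\<dots> = \<beta> * (\<Sum>k\<le>d. w k * (\<phi>1 ^ k * \<phi>0 ^ (d - k))) + (1 - \<beta>) * (w 0 * \<phi>0 ^ d)"
    unfolding atMost_d by (simp add: sum_distrib_left algebra_simps)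
  also have "\<dots> = \<beta> * X + (1 - \<beta>) * Y"
    unfolding X_def Y_def add.commute[of "t * \<phi>0"] binomial_ring
    by (simp add: w_def power_mult_distrib mult_ac)
  finally have lhs2: "(\<Sum>k\<le>d. w k * (\<Prod>i\<in>UNIV. f i k powr \<eta> i)) = \<beta> * X + (1 - \<beta>) * Y" .
  have rhs2: "(\<Prod>i\<in>UNIV. (\<Sum>k\<le>d. w k * f i k) powr \<eta> i)
      = (L ^ d) powr (1 - 1 / s) * bip_density t a d powr (1 / s)"
    by (simp add: UNIV_bool M_True M_False \<eta>_def)
  have step2: "\<beta> * X + (1 - \<beta>) * Y \<le> (L ^ d) powr (1 - 1 / s) * bip_density t a d powr (1 / s)"
    using holder2[OF _ _ w sw f \<eta>] unfolding lhs2 rhs2 by simp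
  have ra: "bip_density t a d > 0" and rb: "bip_density t b d > 0"
    using t by (auto intro: bip_density_pos)
  have XY: "\<beta> * X + (1 - \<beta>) * Y > 0" using X Y \<beta> by (simp add: add_pos_pos)
  have R_eq: "?R = (bip_density t a d powr (1 / (s * d)) * bip_density t b d powr (real e / d)) powr s"
    using ra rb s d by (simp add: powr_mult powr_powr d_def mult.commute)
  have root: "(\<beta> * X + (1 - \<beta>) * Y) powr (1 / real d)
      \<le> L powr (1 - 1 / s) * bip_density t a d powr (1 / (s * d))"
  proof -
    have "(\<beta> * X + (1 - \<beta>) * Y) powr (1 / real d)
      \<le> ((L ^ d) powr (1 - 1 / s) * bip_density t a d powr (1 / s)) powr (1 / real d)"
      using step2 XY by (intro powr_mono2) auto
    also have "\<dots> = L powr (1 - 1 / s) * bip_density t a d powr (1 / (s * d))"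
      using L_pos ra d by (simp add: powr_of_power powr_mult powr_powr)
    finally show ?thesis .
  qed
  have split_L: "L = L powr (1 - 1 / s) * L powr (1 / s)"
    using L_pos by (simp flip: powr_add)
  have final: "L = (L powr (1 / s)) powr s" using L_pos s by (simp add: powr_powr)
  have chain: "L \<le> L powr (1 - 1 / s) *
      (bip_density t a d powr (1 / (s * d)) * bip_density t b d powr (real e / d))"
    using order.trans[OF step1 mult_right_mono[OF root]] by (simp add: mult_ac)
  then have "L powr (1 / s) \<le> bip_density t a d powr (1 / (s * d)) * bip_density t b d powr (real e / d)"
    using L_pos by (subst (asm) (1) split_L) simp
  then have "L \<le> ?R"
    unfolding R_eq by (subst final) (use s in \<open>auto intro!: powr_mono2\<close>)
  then show "?L \<le> ?R" by (simp add: L_def)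
  assume "?L = ?R"
  then have "(L powr (1 / s)) powr s
      = (bip_density t a d powr (1 / (s * d)) * bip_density t b d powr (real e / d)) powr s"
    using final R_eq by (simp add: L_def)
  then have "L powr (1 / s) = bip_density t a d powr (1 / (s * d)) * bip_density t b d powr (real e / d)"
    by (rule powr_inj_base) (use s ra rb L_pos in auto)
  then have "L = L powr (1 - 1 / s) * (bip_density t a d powr (1 / (s * d)) * bip_density t b d powr (real e / d))"
    using split_L by simp
  also have "\<dots> \<ge> (\<beta> * X + (1 - \<beta>) * Y) powr (1 / real d) * bip_density t b d powr (real e / d)"
    using mult_right_mono[OF root, of "bip_density t b d powr (real e / d)"] by (simp add: mult_ac)
  finally have eq1: "L = (\<beta> * X + (1 - \<beta>) * Y) powr (1 / real d) * bip_density t b d powr (real e / d)"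
    using step1 by simp
  have "x True * y False = x False * y True"
    using holder1(2)[OF _ \<beta> xy theta, of True False] lhs1 rhs1 eq1 e d by (simp add: \<theta>_def)
  then have "((t * \<phi>0 + (1 - t) * \<phi>1) * t) ^ d = (t * \<phi>0) ^ d"
    by (simp add: x_def y_def X_def Y_def power_mult_distrib)
  then have "(t * \<phi>0 + (1 - t) * \<phi>1) * t = t * \<phi>0"
    using \<phi> t d by (subst (asm) power_eq_iff_eq_base) (auto intro!: add_nonneg_nonneg)
  then have "t * ((1 - t) * (\<phi>1 - \<phi>0)) = 0" by (simp add: algebra_simps)
  then have "\<phi>1 = \<phi>0" using t by simp
  have "s = 1"
  proof (rule ccontr)
    assume "s \<noteq> 1"
    then have "\<phi>1 < \<phi>0" unfolding \<phi>0_def \<phi>1_def using s T0\<beta> \<beta> by (intro powr_less_mono2) auto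
    then show False using \<open>\<phi>1 = \<phi>0\<close> by simp
  qed
  then show "b = a" using ba by (simp add: s_def)
qed

section \<open>Bipartite graphs\<close>

text \<open>
  The probability that a random subset of the disjoint union of \<open>A\<close> and \<open>B\<close> is independent in the bipartite
  graph given by \<open>R\<close>. The sum ranges over the chosen part \<open>S\<close> of \<open>A\<close>; all vertices of \<open>B\<close> with a neighbour in \<open>S\<close>
  must be left out. The sets \<open>A\<close> and \<open>B\<close> may share elements, so the double cover of a graph on \<open>V\<close> is
  the case \<open>A = B = V\<close>.
\<close>

definition bip_indep_prob :: "real \<Rightarrow> ('a \<Rightarrow> 'b \<Rightarrow> bool) \<Rightarrow> 'a set \<Rightarrow> 'b set \<Rightarrow> real" where
  "bip_indep_prob t R A B =
     (\<Sum>S\<in>Pow A. (1 - t) ^ card S * t ^ card (A - S) * t ^ card {v \<in> B. \<exists>u\<in>S. R u v})"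

definition nbrs_in :: "('a \<Rightarrow> 'b \<Rightarrow> bool) \<Rightarrow> 'a set \<Rightarrow> 'b \<Rightarrow> 'a set" where
  "nbrs_in R A v = {u \<in> A. R u v}"

text \<open>
  The part of the claimed bound that belongs to the edges at \<open>v \<in> B\<close>. The degree of \<open>v\<close> is counted in \<open>A\<close>,
  whereas \<open>d u\<close> is a nominal degree of \<open>u \<in> A\<close> that does not change when \<open>B\<close> is replaced by a subset. A vertex \<open>v\<close>
  without neighbours contributes the empty product 1, in agreement with \<open>bip_density t a 0 = 1\<close>.
\<close>

definition vertex_bound :: "real \<Rightarrow> ('a \<Rightarrow> nat) \<Rightarrow> ('a \<Rightarrow> 'b \<Rightarrow> bool) \<Rightarrow> 'a set \<Rightarrow> 'b \<Rightarrow> real" where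
  "vertex_bound t d R A v =
     (\<Prod>u\<in>nbrs_in R A v. bip_density t (d u) (card (nbrs_in R A v))
        powr (1 / (real (d u) * real (card (nbrs_in R A v)))))"

lemma finite_nbrs_in [simp]: "finite A \<Longrightarrow> finite (nbrs_in R A v)"
  by (simp add: nbrs_in_def)

lemma nbrs_in_insert:
  "nbrs_in R (insert w A) v = (if R w v then insert w (nbrs_in R A v) else nbrs_in R A v)"
  by (auto simp: nbrs_in_def)

lemma vertex_bound_pos:
  assumes "0 < t" "t < 1"
  shows "vertex_bound t d R A v > 0"
  unfolding vertex_bound_def using bip_density_pos[OF assms] by (intro prod_pos) (simp add: less_imp_neq[symmetric])

lemma bip_indep_prob_insert:
  assumes fin: "finite A" "finite B" and w: "w \<notin> A"
  shows "bip_indep_prob t R (insert w A) B = t * bip_indep_prob t R A B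
     + (1 - t) * t ^ card {v \<in> B. R w v} * bip_indep_prob t R A {v \<in> B. \<not> R w v}"
proof -
  define g where "g S = (1 - t) ^ card S * t ^ card (insert w A - S) * t ^ card {v \<in> B. \<exists>u\<in>S. R u v}" for S
  have inj: "inj_on (insert w) (Pow A)"
    using w by (auto simp: inj_on_def)
  have "bip_indep_prob t R (insert w A) B = sum g (Pow A \<union> insert w ` Pow A)"
    by (simp add: bip_indep_prob_def g_def Pow_insert)
  also have "\<dots> = sum g (Pow A) + sum g (insert w ` Pow A)"
    using fin w by (intro sum.union_disjoint) auto
  also have "sum g (Pow A) = t * bip_indep_prob t R A B"
    unfolding bip_indep_prob_def sum_distrib_left
  proof (rule sum.cong)
    fix S assume "S \<in> Pow A"
    then have "insert w A - S = insert w (A - S)" using w by auto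
    then have "card (insert w A - S) = Suc (card (A - S))" using w fin by simp
    then show "g S = t * ((1 - t) ^ card S * t ^ card (A - S) * t ^ card {v \<in> B. \<exists>u\<in>S. R u v})"
      by (simp add: g_def)
  qed simp
  also have "sum g (insert w ` Pow A) = (\<Sum>S\<in>Pow A. g (insert w S))"
    using inj by (simp add: sum.reindex)
  also have "\<dots> = (1 - t) * t ^ card {v \<in> B. R w v} * bip_indep_prob t R A {v \<in> B. \<not> R w v}"
    unfolding bip_indep_prob_def sum_distrib_left
  proof (rule sum.cong)
    fix S assume S: "S \<in> Pow A"
    have "insert w A - insert w S = A - S" using w by auto
    moreover have "card (insert w S) = Suc (card S)"
      using S w fin by (auto simp: finite_subset intro!: card_insert_disjoint)
    moreover have "card {v \<in> B. \<exists>u\<in>insert w S. R u v} =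
        card {v \<in> B. R w v} + card {v \<in> {v \<in> B. \<not> R w v}. \<exists>u\<in>S. R u v}"
      using fin by (subst card_Un_disjoint[symmetric]) (auto intro!: arg_cong[of _ _ card])
    ultimately show "g (insert w S) = (1 - t) * t ^ card {v \<in> B. R w v} * ((1 - t) ^ card S
        * t ^ card (A - S) * t ^ card {v \<in> {v \<in> B. \<not> R w v}. \<exists>u\<in>S. R u v})"
      by (simp add: g_def power_add)
  qed simp
  finally show ?thesis .
qed

lemma prod_eq_imp_factors_eq:
  fixes f g :: "'i \<Rightarrow> real"
  assumes "finite I" "\<And>i. i \<in> I \<Longrightarrow> 0 < f i" "\<And>i. i \<in> I \<Longrightarrow> f i \<le> g i"
    and "prod f I = prod g I" "i \<in> I"
  shows "f i = g i"
proof (rule ccontr)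
  assume "f i \<noteq> g i"
  then have "f i < g i" using assms by (simp add: less_le)
  moreover have "0 < g j" if "j \<in> I" for j
    using assms(2,3)[OF that] by (rule less_le_trans)
  ultimately have "prod f I < prod g I"
    using assms by (intro prod_mono_strict[of i]) (auto intro: less_imp_le)
  then show False using assms by simp
qed

text \<open>
  The effect of adding \<open>w\<close> on the bound at one of its neighbours \<open>v\<close>. The term \<open>t ^ d w\<close> is the power of the
  probability \<open>t\<close> that \<open>v\<close> is left out, as it must be if \<open>w\<close> is chosen. Hoelder's inequality with equal weights
  over the old neighbours \<open>u\<close> of \<open>v\<close> separates them, and \<open>local_inequality\<close> with \<open>b = d u\<close> bounds
  each factor.
\<close>

lemma vertex_step:
  fixes t :: real and d :: "'a \<Rightarrow> nat"
  assumes t: "0 < t" "t < 1" and A: "finite A" "w \<notin> A" and Rw: "R w v"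
    and d: "\<And>u. u \<in> A \<Longrightarrow> 1 \<le> d u" "\<And>u. u \<in> A \<Longrightarrow> d u \<le> d w" "1 \<le> d w"
  shows "t * vertex_bound t d R A v powr d w + (1 - t) * t ^ d w
           \<le> vertex_bound t d R (insert w A) v powr d w"
    and "\<lbrakk>t * vertex_bound t d R A v powr d w + (1 - t) * t ^ d w
           = vertex_bound t d R (insert w A) v powr d w; u \<in> A; R u v\<rbrakk> \<Longrightarrow> d u = d w"
proof -
  define N where "N = nbrs_in R A v"
  define e where "e = card N"
  define a where "a = d w"
  have N: "finite N" "w \<notin> N" "\<And>u. u \<in> N \<Longrightarrow> u \<in> A"
    using A by (auto simp: N_def nbrs_in_def)
  have a: "a \<ge> 1" using d by (simp add: a_def)
  have N': "nbrs_in R (insert w A) v = insert w N"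
    using Rw by (simp add: nbrs_in_insert N_def)
  have e': "card (insert w N) = e + 1" using N by (simp add: e_def)
  note pos = bip_density_pos[OF t]
  have old: "vertex_bound t d R A v = (\<Prod>u\<in>N. bip_density t (d u) e powr (1 / (d u * e)))"
    by (simp add: vertex_bound_def N_def e_def)
  have "vertex_bound t d R (insert w A) v
      = (\<Prod>u\<in>insert w N. bip_density t (d u) (e + 1) powr (1 / (real (d u) * real (e + 1))))"
    unfolding vertex_bound_def N' e' ..
  also have "\<dots> = bip_density t a (e + 1) powr (1 / (real a * real (e + 1)))
      * (\<Prod>u\<in>N. bip_density t (d u) (e + 1) powr (1 / (real (d u) * real (e + 1))))"
    using N by (simp add: a_def)
  finally have new: "vertex_bound t d R (insert w A) v = \<dots>" .
  have new_powr: "vertex_bound t d R (insert w A) v powr a = bip_density t a (e + 1) powr (1 / (e + 1))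
      * (\<Prod>u\<in>N. bip_density t (d u) (e + 1) powr (a / (real (d u) * real (e + 1))))"
    unfolding new using pos a
    by (simp add: powr_mult prod_powr_distrib powr_powr less_imp_le prod_nonneg)
  have "t * vertex_bound t d R A v powr a + (1 - t) * t ^ a
           \<le> vertex_bound t d R (insert w A) v powr a \<and>
        (t * vertex_bound t d R A v powr a + (1 - t) * t ^ a
           = vertex_bound t d R (insert w A) v powr a \<longrightarrow> (\<forall>u\<in>N. d u = a))"
  proof (cases "e = 0")
    \<comment> \<open>both sides equal \<open>bip_density t a 1\<close>\<close>
    case True
    then have "N = {}" using N by (simp add: e_def)
    then show ?thesis
      unfolding new_powr old using True pos[of a 1] by (simp add: bip_density_def algebra_simps)
  next
    case False
    then have e: "e \<ge> 1" by simp
    define x where "x u = bip_density t (d u) e powr (real a / real (d u))" for u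
    define z where "z u = bip_density t a (e + 1) powr (1 / real (e + 1))
             * bip_density t (d u) (e + 1) powr ((real a / real (d u)) * (real e / real (e + 1)))" for u
    have x: "x u > 0" and z: "z u > 0" for u using pos by (auto simp: x_def z_def less_imp_neq[symmetric])
    have xz: "t * x u + (1 - t) * t ^ a \<le> z u" if "u \<in> N" for u
      unfolding x_def z_def using t d N e that by (intro local_inequality) (auto simp: a_def)
    have xz_eq: "d u = a" if "u \<in> N" "t * x u + (1 - t) * t ^ a = z u" for u
      by (rule local_inequality(2)[OF t _ _ e that(2)[unfolded x_def z_def]])
         (use d N that(1) in \<open>auto simp: a_def\<close>)
    have px: "(\<Prod>u\<in>N. x u powr (1 / e)) = vertex_bound t d R A v powr a"
      unfolding old x_def using pos by (simp add: prod_powr_distrib powr_powr less_imp_le)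
    have py: "(\<Prod>u\<in>N. (t ^ a) powr (1 / e)) = t ^ a"
      using t e by (simp add: powr_realpow[symmetric] powr_powr flip: e_def)
    have pz: "(\<Prod>u\<in>N. z u powr (1 / e)) = vertex_bound t d R (insert w A) v powr a"
    proof -
      have "(\<Prod>u\<in>N. z u powr (1 / e)) = (\<Prod>u\<in>N. (bip_density t a (e + 1) powr (1 / real (e + 1))) powr (1 / e)
             * bip_density t (d u) (e + 1) powr (real a / (real (d u) * real (e + 1))))"
        unfolding z_def using e pos by (intro prod.cong) (auto simp: powr_mult powr_powr less_imp_le)
      also have "\<dots> = vertex_bound t d R (insert w A) v powr a"
        unfolding new_powr using e pos[of a "e + 1"]
        by (simp add: prod.distrib powr_powr powr_realpow[symmetric] flip: e_def)
      finally show ?thesis .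
    qed
    have base: "t * x u + (1 - t) * t ^ a > 0" for u using t x by (simp add: add_pos_pos)
    have le1: "t * vertex_bound t d R A v powr a + (1 - t) * t ^ a
        \<le> (\<Prod>u\<in>N. (t * x u + (1 - t) * t ^ a) powr (1 / e))"
      using holder_two_point(1)[OF N(1) t, of x "\<lambda>_. t ^ a" "\<lambda>_. 1 / e"] x t e
      by (simp add: px py e_def[symmetric] del: prod_constant)
    have factor: "(t * x u + (1 - t) * t ^ a) powr (1 / e) \<le> z u powr (1 / e)" if "u \<in> N" for u
      using xz[OF that] base e by (intro powr_mono2) (auto intro: less_imp_le)
    then have le2: "(\<Prod>u\<in>N. (t * x u + (1 - t) * t ^ a) powr (1 / e))
        \<le> (\<Prod>u\<in>N. z u powr (1 / e))" by (intro prod_mono) auto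
    show ?thesis
    proof (intro conjI impI ballI)
      show "t * vertex_bound t d R A v powr a + (1 - t) * t ^ a \<le> vertex_bound t d R (insert w A) v powr a"
        using le1 le2 pz by linarith
      fix u assume "t * vertex_bound t d R A v powr a + (1 - t) * t ^ a
         = vertex_bound t d R (insert w A) v powr a" and u: "u \<in> N"
      then have "(\<Prod>u\<in>N. (t * x u + (1 - t) * t ^ a) powr (1 / e)) = (\<Prod>u\<in>N. z u powr (1 / e))"
        using le1 le2 pz by linarith
      then have "(t * x u + (1 - t) * t ^ a) powr (1 / e) = z u powr (1 / e)"
        using base N(1) factor u
        by (intro prod_eq_imp_factors_eq[of N "\<lambda>u. (t * x u + (1 - t) * t ^ a) powr (1 / e)"])
           (auto simp: less_imp_neq[symmetric])
      then have "t * x u + (1 - t) * t ^ a = z u"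
        by (rule powr_inj_base) (use base z e in auto)
      then show "d u = a" using xz_eq u by simp
    qed
  qed
  then show "t * vertex_bound t d R A v powr d w + (1 - t) * t ^ d w
           \<le> vertex_bound t d R (insert w A) v powr d w"
    and "t * vertex_bound t d R A v powr d w + (1 - t) * t ^ d w
           = vertex_bound t d R (insert w A) v powr d w \<Longrightarrow> u \<in> A \<Longrightarrow> R u v \<Longrightarrow> d u = d w"
    unfolding a_def N_def nbrs_in_def by blast+
qed

text \<open>
  The left-hand side is the bound obtained by conditioning on \<open>w\<close>. Only the neighbours of \<open>w\<close> matter, since the
  other factors agree on both sides; Hoelder's inequality with weights \<open>1 / d w\<close> separates them. In the
  equality case, all factors from \<open>vertex_step\<close> are equalities, which gives the second claim. The third
  follows from the equality case of Hoelder's inequality: the factors \<open>vertex_bound t d R A v\<close>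
  agree for all neighbours \<open>v\<close> of \<open>w\<close>, and by the second claim they are a strictly
  decreasing function of the degree of \<open>v\<close>.
\<close>

lemma vertex_removal_step:
  fixes t :: real and d :: "'a \<Rightarrow> nat"
  assumes t: "0 < t" "t < 1" and fin: "finite A" "finite B" and w: "w \<notin> A"
    and d: "\<And>u. u \<in> A \<Longrightarrow> 1 \<le> d u" "\<And>u. u \<in> A \<Longrightarrow> d u \<le> d w" "1 \<le> d w"
    and deg: "card {v \<in> B. R w v} \<le> d w"
  defines "lhs \<equiv> t * (\<Prod>v\<in>B. vertex_bound t d R A v)
     + (1 - t) * t ^ card {v \<in> B. R w v} * (\<Prod>v\<in>{v \<in> B. \<not> R w v}. vertex_bound t d R A v)"
    and "rhs \<equiv> (\<Prod>v\<in>B. vertex_bound t d R (insert w A) v)"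
  shows "lhs \<le> rhs"
    and "\<lbrakk>lhs = rhs; v \<in> B; R w v; u \<in> A; R u v\<rbrakk> \<Longrightarrow> d u = d w"
    and "\<lbrakk>lhs = rhs; v \<in> B; R w v; v' \<in> B; R w v'\<rbrakk>
           \<Longrightarrow> card (nbrs_in R A v) = card (nbrs_in R A v')"
proof -
  define N where "N = {v \<in> B. R w v}"
  define B' where "B' = {v \<in> B. \<not> R w v}"
  define a where "a = d w"
  define \<rho> where "\<rho> v = vertex_bound t d R A v" for v
  define \<rho>' where "\<rho>' v = vertex_bound t d R (insert w A) v" for v
  define C where "C = prod \<rho> B'"
  have a: "a \<ge> 1" using d by (simp add: a_def)
  have N: "finite N" "card N \<le> a" "\<And>v. v \<in> N \<Longrightarrow> R w v" using fin deg by (auto simp: N_def a_def)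
  have \<rho>: "\<rho> v > 0" "\<rho>' v > 0" for v using vertex_bound_pos[OF t] by (simp_all add: \<rho>_def \<rho>'_def)
  have C: "C > 0" unfolding C_def using \<rho> by (intro prod_pos) auto
  have split_prod: "prod f B = prod f N * prod f B'" for f :: "'b \<Rightarrow> real"
    unfolding N_def B'_def using fin
    by (subst prod.union_disjoint[symmetric]) (auto intro!: prod.cong)
  have "prod \<rho>' B' = C"
    unfolding C_def by (intro prod.cong) (auto simp: \<rho>_def \<rho>'_def B'_def vertex_bound_def nbrs_in_insert)
  then have rhs: "rhs = prod \<rho>' N * C"
    unfolding rhs_def \<rho>'_def[symmetric] split_prod by simp
  define Q where "Q = t * prod \<rho> N + (1 - t) * t ^ card N"
  have lhs: "lhs = Q * C"
    unfolding lhs_def \<rho>_def[symmetric] split_prod N_def[symmetric] B'_def[symmetric] C_def[symmetric] Q_def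
    by (simp add: algebra_simps)
  define m where "m v = t * \<rho> v powr a + (1 - t) * t ^ a" for v
  have m: "m v > 0" for v using \<rho> t by (simp add: m_def add_pos_pos less_imp_neq[symmetric])
  have theta: "(\<Sum>v\<in>N. 1 / real a) \<le> 1" using N a by (simp add: divide_le_eq_1)
  have prod_x: "(\<Prod>v\<in>N. (\<rho> v powr a) powr (1 / a)) = prod \<rho> N"
    using a \<rho> by (simp add: powr_powr less_imp_le)
  have prod_y: "(\<Prod>v\<in>N. (t ^ a) powr (1 / a)) = t ^ card N"
    using a t by (simp add: powr_powr flip: powr_realpow)
  note holder = holder_two_point[OF N(1) t, of "\<lambda>v. \<rho> v powr a" "\<lambda>_. t ^ a" "\<lambda>_. 1 / real a",
      unfolded prod_x prod_y m_def[symmetric] Q_def[symmetric], OF _ _ _ theta]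
  have le1: "Q \<le> (\<Prod>v\<in>N. m v powr (1 / a))"
    using \<rho> t by (intro holder(1)) (auto simp: less_imp_neq[symmetric])
  have m_le: "m v \<le> \<rho>' v powr a" if "v \<in> N" for v
    unfolding m_def \<rho>_def \<rho>'_def a_def using that t fin w d N by (intro vertex_step(1)) auto
  have factor: "m v powr (1 / a) \<le> \<rho>' v" if "v \<in> N" for v
  proof -
    have "m v powr (1 / a) \<le> (\<rho>' v powr a) powr (1 / a)"
      using m_le[OF that] m by (intro powr_mono2) (auto intro: less_imp_le)
    then show ?thesis using \<rho> a by (simp add: powr_powr less_imp_le)
  qed
  have le2: "(\<Prod>v\<in>N. m v powr (1 / a)) \<le> prod \<rho>' N"
    using factor by (intro prod_mono) auto
  show "lhs \<le> rhs"
    unfolding lhs rhs using le1 le2 C by (intro mult_right_mono) auto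
  have eqs: "Q = (\<Prod>v\<in>N. m v powr (1 / a))" "(\<Prod>v\<in>N. m v powr (1 / a)) = prod \<rho>' N" if "lhs = rhs"
    using that le1 le2 C unfolding lhs rhs by auto
  have max_deg: "d u = a" if eq: "lhs = rhs" and v: "v \<in> N" and u: "u \<in> A" "R u v" for u v
  proof -
    have "m v powr (1 / a) = \<rho>' v"
      using m N(1) factor v eqs(2)[OF eq]
      by (intro prod_eq_imp_factors_eq[of N "\<lambda>v. m v powr (1 / a)" \<rho>'])
         (auto simp: less_imp_neq[symmetric])
    then have "(m v powr (1 / a)) powr a = \<rho>' v powr a" by simp
    then have "m v = \<rho>' v powr a" using m[of v] a by (simp add: powr_powr)
    then have "t * vertex_bound t d R A v powr d w + (1 - t) * t ^ d w
        = vertex_bound t d R (insert w A) v powr d w"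
      by (simp add: m_def \<rho>_def \<rho>'_def a_def)
    from vertex_step(2)[OF t fin(1) w _ _ _ _ this] show ?thesis
      using d N v u by (simp add: a_def)
  qed
  then show "\<lbrakk>lhs = rhs; v \<in> B; R w v; u \<in> A; R u v\<rbrakk> \<Longrightarrow> d u = d w"
    by (auto simp: N_def a_def)
  assume eq: "lhs = rhs" and "v \<in> B" "R w v" "v' \<in> B" "R w v'"
  then have vv': "v \<in> N" "v' \<in> N" by (auto simp: N_def)
  have "\<rho> v powr a * t ^ a = \<rho> v' powr a * t ^ a"
    by (rule holder(2)) (use eqs(1)[OF eq] vv' \<rho> t a in \<open>auto simp: less_imp_neq[symmetric]\<close>)
  then have "\<rho> v powr a = \<rho> v' powr a" using t by simp
  moreover have "\<rho> x powr a = bip_density t a (card (nbrs_in R A x))" if "x \<in> N" for x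
  proof -
    define e where "e = card (nbrs_in R A x)"
    have "\<rho> x = (\<Prod>u\<in>nbrs_in R A x. bip_density t a e powr (1 / (real a * real e)))"
      unfolding \<rho>_def vertex_bound_def e_def[symmetric]
      using max_deg[OF eq that] by (intro prod.cong) (auto simp: nbrs_in_def)
    then have "\<rho> x = (bip_density t a e powr (1 / (real a * real e))) ^ e" by (simp add: e_def)
    also have "\<dots> powr a = bip_density t a e"
      using bip_density_pos[OF t, of a e] a
      by (cases "e = 0") (auto simp: powr_of_power powr_powr)
    finally show ?thesis by (simp add: e_def)
  qed
  ultimately show "card (nbrs_in R A v) = card (nbrs_in R A v')"
    using vv' bip_density_eq_iff[OF t] a by auto
qed

text \<open>
  Induction on \<open>A\<close>, where the vertex with the largest nominal degree is the last one to be inserted. The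
  set \<open>B\<close> varies because the neighbours of a chosen vertex are deleted.
\<close>

theorem bip_indep_prob_le:
  fixes t :: real and d :: "'a \<Rightarrow> nat"
  assumes t: "0 < t" "t < 1" and "finite A" "finite B"
    and "\<And>u. u \<in> A \<Longrightarrow> 1 \<le> d u" "\<And>u. u \<in> A \<Longrightarrow> card {v \<in> B. R u v} \<le> d u"
  shows "bip_indep_prob t R A B \<le> (\<Prod>v\<in>B. vertex_bound t d R A v)"
  using assms(3-)
proof (induction A arbitrary: B rule: finite_ranking_induct[where f = d])
  case empty
  then show ?case by (simp add: bip_indep_prob_def vertex_bound_def nbrs_in_def)
next
  case (insert w A B)
  show ?case
  proof (cases "w \<in> A")
    case True
    then show ?thesis using insert by (simp add: insert_absorb)
  next
    case False
    let ?B' = "{v \<in> B. \<not> R w v}"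
    have "card {v \<in> ?B'. R u v} \<le> card {v \<in> B. R u v}" for u
      using insert.prems by (intro card_mono) auto
    then have "bip_indep_prob t R A ?B' \<le> (\<Prod>v\<in>?B'. vertex_bound t d R A v)"
      using insert.prems by (intro insert.IH) (auto intro: order.trans)
    moreover have "bip_indep_prob t R A B \<le> (\<Prod>v\<in>B. vertex_bound t d R A v)"
      using insert.prems by (intro insert.IH) auto
    ultimately have "bip_indep_prob t R (insert w A) B \<le> t * (\<Prod>v\<in>B. vertex_bound t d R A v)
       + (1 - t) * t ^ card {v \<in> B. R w v} * (\<Prod>v\<in>?B'. vertex_bound t d R A v)"
      unfolding bip_indep_prob_insert[OF insert.hyps(1) insert.prems(1) False] using t
      by (intro add_mono mult_left_mono) auto
    also have "\<dots> \<le> (\<Prod>v\<in>B. vertex_bound t d R (insert w A) v)"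
      using t insert False by (intro vertex_removal_step(1)) auto
    finally show ?thesis .
  qed
qed

lemma bip_indep_prob_eq_remove:
  fixes t :: real and d :: "'a \<Rightarrow> nat"
  assumes t: "0 < t" "t < 1" and fin: "finite A" "finite B" and w: "w \<notin> A"
    and d: "\<And>u. u \<in> insert w A \<Longrightarrow> 1 \<le> d u"
      "\<And>u. u \<in> insert w A \<Longrightarrow> card {v \<in> B. R u v} \<le> d u"
    and max: "\<And>u. u \<in> A \<Longrightarrow> d u \<le> d w"
    and eq: "bip_indep_prob t R (insert w A) B = (\<Prod>v\<in>B. vertex_bound t d R (insert w A) v)"
  shows "bip_indep_prob t R A B = (\<Prod>v\<in>B. vertex_bound t d R A v)"
    and "\<lbrakk>v \<in> B; R w v; u \<in> A; R u v\<rbrakk> \<Longrightarrow> d u = d w"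
    and "\<lbrakk>v \<in> B; R w v; v' \<in> B; R w v'\<rbrakk> \<Longrightarrow> card (nbrs_in R A v) = card (nbrs_in R A v')"
proof -
  let ?B' = "{v \<in> B. \<not> R w v}"
  let ?lhs = "t * (\<Prod>v\<in>B. vertex_bound t d R A v)
     + (1 - t) * t ^ card {v \<in> B. R w v} * (\<Prod>v\<in>?B'. vertex_bound t d R A v)"
  have le1: "bip_indep_prob t R A B \<le> (\<Prod>v\<in>B. vertex_bound t d R A v)"
    using t fin d by (intro bip_indep_prob_le) auto
  have "card {v \<in> ?B'. R u v} \<le> card {v \<in> B. R u v}" for u
    using fin by (intro card_mono) auto
  then have "bip_indep_prob t R A ?B' \<le> (\<Prod>v\<in>?B'. vertex_bound t d R A v)"
    using t fin d by (intro bip_indep_prob_le) (auto intro: order.trans)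
  then have le2: "(1 - t) * t ^ card {v \<in> B. R w v} * bip_indep_prob t R A ?B'
     \<le> (1 - t) * t ^ card {v \<in> B. R w v} * (\<Prod>v\<in>?B'. vertex_bound t d R A v)"
    using t by (intro mult_left_mono) auto
  note step = vertex_removal_step[OF t fin w, of d R]
  have le3: "?lhs \<le> (\<Prod>v\<in>B. vertex_bound t d R (insert w A) v)"
    using d max by (intro step(1)) auto
  note rec = bip_indep_prob_insert[OF fin w, of t R]
  have "t * bip_indep_prob t R A B \<le> t * (\<Prod>v\<in>B. vertex_bound t d R A v)"
    using le1 t by simp
  then have lhs_eq: "?lhs = (\<Prod>v\<in>B. vertex_bound t d R (insert w A) v)"
    and "t * bip_indep_prob t R A B = t * (\<Prod>v\<in>B. vertex_bound t d R A v)"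
    using le2 le3 eq rec by linarith+
  then show "bip_indep_prob t R A B = (\<Prod>v\<in>B. vertex_bound t d R A v)"
    using t by simp
  show "\<lbrakk>v \<in> B; R w v; u \<in> A; R u v\<rbrakk> \<Longrightarrow> d u = d w"
    by (rule step(2)[OF _ _ _ _ lhs_eq]) (use d max in auto)
  show "\<lbrakk>v \<in> B; R w v; v' \<in> B; R w v'\<rbrakk> \<Longrightarrow> card (nbrs_in R A v) = card (nbrs_in R A v')"
    by (rule step(3)[OF _ _ _ _ lhs_eq]) (use d max in auto)
qed

text \<open>
  Let \<open>w\<close> have largest degree. The relation without \<open>w\<close> is closed by induction, so only walks through \<open>w\<close> have
  to be considered. On such a walk, all vertices of \<open>A\<close> at distance two from \<open>w\<close> have the degree of \<open>w\<close>,
  so \<open>bip_indep_prob_eq_remove\<close> applies to them as well as to \<open>w\<close>; this is \<open>local_structure\<close>.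
\<close>

theorem bip_indep_prob_eq_imp_closed:
  fixes t :: real and d :: "'a \<Rightarrow> nat"
  assumes t: "0 < t" "t < 1" and "finite A" "finite B"
    and "\<And>u. u \<in> A \<Longrightarrow> 1 \<le> d u" "\<And>u. u \<in> A \<Longrightarrow> card {v \<in> B. R u v} = d u"
    and "bip_indep_prob t R A B = (\<Prod>v\<in>B. vertex_bound t d R A v)"
    and "x \<in> A" "y \<in> B" "x' \<in> A" "y' \<in> B" "R x y" "R x' y" "R x' y'"
  shows "R x y'"
  using assms(3-)
proof (induction A arbitrary: x y x' y' rule: finite_ranking_induct[where f = d])
  case empty
  then show ?case by simp
next
  case (insert w A)
  let ?A = "insert w A"
  show ?case
  proof (cases "w \<in> A")
    case True
    then have "insert w A = A" by auto
    then show ?thesis using insert.prems by (intro insert.IH[of x y x' y']) simp_all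
  next
    case False
    have local_structure: "d u = d z" "card (nbrs_in R ?A v) = card (nbrs_in R ?A v')"
      if z: "z \<in> ?A" "d z = d w" and v: "v \<in> B" "R z v" "v' \<in> B" "R z v'"
        and u: "u \<in> ?A" "R u v" for z u v v'
    proof -
      have ins: "insert z (?A - {z}) = ?A" using z by auto
      note step = bip_indep_prob_eq_remove[OF t, of "?A - {z}" B z d R, unfolded ins]
      show "d u = d z"
        by (cases "u = z", simp, rule step(2)[of v]) (use insert.prems insert.hyps z v u in auto)
      have "nbrs_in R ?A x = insert z (nbrs_in R (?A - {z}) x)" "z \<notin> nbrs_in R (?A - {z}) x"
        if "R z x" for x using that z by (auto simp: nbrs_in_def)
      then have "card (nbrs_in R ?A x) = Suc (card (nbrs_in R (?A - {z}) x))" if "R z x" for x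
        using that insert.hyps by simp
      moreover have "card (nbrs_in R (?A - {z}) v) = card (nbrs_in R (?A - {z}) v')"
        by (rule step(3)[of v v']) (use insert.prems insert.hyps z v in auto)
      ultimately show "card (nbrs_in R ?A v) = card (nbrs_in R ?A v')" using v by simp
    qed
    have eqA: "bip_indep_prob t R A B = (\<Prod>v\<in>B. vertex_bound t d R A v)"
      by (rule bip_indep_prob_eq_remove(1)[OF t _ _ False]) (use insert.prems insert.hyps in auto)
    have IH: "R p q'" if "p \<in> A" "q \<in> B" "p' \<in> A" "q' \<in> B" "R p q" "R p' q" "R p' q'" for p q p' q'
      by (rule insert.IH[of p q p' q']) (use that insert.prems eqA in auto)
    have from_w: "R w q'" if q: "q \<in> B" "p' \<in> A" "q' \<in> B" "R w q" "R p' q" "R p' q'" for q p' q'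
    \<comment> \<open>By induction \<open>q\<close> and \<open>q'\<close> have the same neighbours apart from \<open>w\<close>, and the same degree because
      \<open>p'\<close> has largest degree; so \<open>w\<close> cannot be adjacent to only one of them.\<close>
    proof (rule ccontr)
      assume "\<not> R w q'"
      then have "card (nbrs_in R ?A q') = card (nbrs_in R A q')" by (simp add: nbrs_in_insert)
      also have "nbrs_in R A q' = nbrs_in R A q"
      proof -
        have "R p q' \<longleftrightarrow> R p q" if "p \<in> A" for p
          using IH[of p q' p' q] IH[of p q p' q'] q that by blast
        then show ?thesis by (auto simp: nbrs_in_def)
      qed
      also have "card \<dots> < card (nbrs_in R ?A q)"
      proof -
        have "w \<notin> nbrs_in R A q" using False by (simp add: nbrs_in_def)
        then show ?thesis using q insert.hyps by (simp add: nbrs_in_insert)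
      qed
      finally have "card (nbrs_in R ?A q') < card (nbrs_in R ?A q)" .
      moreover have "d p' = d w" using local_structure(1)[of w q q p'] q by auto
      then have "card (nbrs_in R ?A q) = card (nbrs_in R ?A q')"
        using local_structure(2)[of p' q q' p'] q by auto
      ultimately show False by simp
    qed
    consider "x = x'" | "x \<in> A" "x' \<in> A" | "x = w" "x' \<in> A" | "x \<in> A" "x' = w"
      using insert.prems by blast
    then show ?thesis
    proof cases
      case 1 then show ?thesis using insert.prems by simp
    next
      case 2 then show ?thesis using insert.prems by (intro IH[of x y x' y'])
    next
      case 3 then show ?thesis using insert.prems from_w[of y x' y'] by simp
    next
      case 4
      \<comment> \<open>The fact \<open>from_w\<close> shows one inclusion of neighbourhoods; both have the same size.\<close>
      have "{v \<in> B. R x v} \<subseteq> {v \<in> B. R w v}"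
      proof
        fix v assume "v \<in> {v \<in> B. R x v}"
        then show "v \<in> {v \<in> B. R w v}"
          using from_w[of y x v] 4 insert.prems(6,8,9,10,11) by blast
      qed
      moreover have "d x = d w" using local_structure(1)[of w y y x] 4 insert.prems by auto
      then have "card {v \<in> B. R x v} = card {v \<in> B. R w v}" using insert.prems by auto
      ultimately have "{v \<in> B. R x v} = {v \<in> B. R w v}"
        using insert.prems by (intro card_subset_eq) auto
      then show ?thesis using 4 insert.prems by auto
    qed
  qed
qed

section \<open>Independence polynomials and the bipartite double cover\<close>

definition indep_poly_on :: "('a \<Rightarrow> 'a \<Rightarrow> bool) \<Rightarrow> 'a set \<Rightarrow> real \<Rightarrow> real" where
  "indep_poly_on E C x = (\<Sum>I | I \<subseteq> C \<and> (\<forall>u\<in>I. \<forall>v\<in>I. \<not> E u v). x ^ card I)"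

lemma sum_Pow_power_card:
  fixes x :: real
  assumes "finite M"
  shows "(\<Sum>T\<in>Pow M. x ^ card T) = (1 + x) ^ card M"
  using prod_add[OF assms, of "\<lambda>_. x" "\<lambda>_. 1"] by (simp add: add.commute)

lemma indep_poly_on_complete_bipartite:
  assumes "finite U" "finite W" "U \<inter> W = {}"
    and "\<And>x y. x \<in> U \<Longrightarrow> y \<in> W \<Longrightarrow> E x y"
    and "\<And>x y. x \<in> U \<Longrightarrow> y \<in> U \<Longrightarrow> \<not> E x y" "\<And>x y. x \<in> W \<Longrightarrow> y \<in> W \<Longrightarrow> \<not> E x y"
  shows "indep_poly_on E (U \<union> W) x = (1 + x) ^ card U + (1 + x) ^ card W - 1"
proof -
  have "{I. I \<subseteq> U \<union> W \<and> (\<forall>u\<in>I. \<forall>v\<in>I. \<not> E u v)} = Pow U \<union> Pow W"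
  proof (intro equalityI subsetI)
    fix I assume I: "I \<in> {I. I \<subseteq> U \<union> W \<and> (\<forall>u\<in>I. \<forall>v\<in>I. \<not> E u v)}"
    show "I \<in> Pow U \<union> Pow W"
    proof (rule ccontr)
      assume "I \<notin> Pow U \<union> Pow W"
      then obtain a b where "a \<in> I" "a \<notin> U" "b \<in> I" "b \<notin> W" by auto
      moreover from this have "a \<in> W" "b \<in> U" using I by auto
      ultimately show False using I assms(4)[of b a] by auto
    qed
  next
    fix I assume "I \<in> Pow U \<union> Pow W"
    then have "\<not> E u v" if "u \<in> I" "v \<in> I" for u v
      using assms(5)[of u v] assms(6)[of u v] that by auto
    then show "I \<in> {I. I \<subseteq> U \<union> W \<and> (\<forall>u\<in>I. \<forall>v\<in>I. \<not> E u v)}"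
      using \<open>I \<in> Pow U \<union> Pow W\<close> by auto
  qed
  moreover have "Pow U \<inter> Pow W = {{}}" using assms(3) by blast
  moreover have "(\<Sum>I\<in>Pow U \<union> Pow W. x ^ card I) + (\<Sum>I\<in>Pow U \<inter> Pow W. x ^ card I)
      = (\<Sum>I\<in>Pow U. x ^ card I) + (\<Sum>I\<in>Pow W. x ^ card I)"
    using assms by (intro sum.union_inter) auto
  ultimately show ?thesis
    using assms by (simp add: indep_poly_on_def sum_Pow_power_card)
qed

lemma indep_poly_on_Un:
  assumes fin: "finite A" "finite B" and disj: "A \<inter> B = {}"
    and no_edge: "\<And>x y. x \<in> A \<Longrightarrow> y \<in> B \<Longrightarrow> \<not> E x y \<and> \<not> E y x"
  shows "indep_poly_on E (A \<union> B) x = indep_poly_on E A x * indep_poly_on E B x"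
proof -
  define Ind where "Ind C = {I. I \<subseteq> C \<and> (\<forall>u\<in>I. \<forall>v\<in>I. \<not> E u v)}" for C
  have inj: "inj_on (\<lambda>(I, J). I \<union> J) (Ind A \<times> Ind B)"
  proof (rule inj_onI, clarify)
    fix I J I' J'
    assume *: "I \<in> Ind A" "J \<in> Ind B" "I' \<in> Ind A" "J' \<in> Ind B" and eq: "I \<union> J = I' \<union> J'"
    have parts: "P = (P \<union> Q) \<inter> A \<and> Q = (P \<union> Q) \<inter> B" if "P \<in> Ind A" "Q \<in> Ind B" for P Q
      using that disj unfolding Ind_def by auto
    show "I = I' \<and> J = J'" using parts[OF *(1,2)] parts[OF *(3,4)] eq by simp
  qed
  have img: "(\<lambda>(I, J). I \<union> J) ` (Ind A \<times> Ind B) = Ind (A \<union> B)"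
  proof
    show "(\<lambda>(I, J). I \<union> J) ` (Ind A \<times> Ind B) \<subseteq> Ind (A \<union> B)"
    proof clarify
      fix I J assume IJ: "I \<in> Ind A" "J \<in> Ind B"
      have "\<not> E u v" if "u \<in> I \<union> J" "v \<in> I \<union> J" for u v
      proof -
        have "I \<subseteq> A" "J \<subseteq> B" and indep: "\<And>u v. u \<in> I \<Longrightarrow> v \<in> I \<Longrightarrow> \<not> E u v"
          "\<And>u v. u \<in> J \<Longrightarrow> v \<in> J \<Longrightarrow> \<not> E u v"
          using IJ by (simp_all add: Ind_def)
        then show ?thesis using that no_edge by (metis UnE subsetD)
      qed
      moreover have "I \<union> J \<subseteq> A \<union> B" using IJ unfolding Ind_def by blast
      ultimately show "I \<union> J \<in> Ind (A \<union> B)" unfolding Ind_def by blast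
    qed
    show "Ind (A \<union> B) \<subseteq> (\<lambda>(I, J). I \<union> J) ` (Ind A \<times> Ind B)"
    proof
      fix I assume I: "I \<in> Ind (A \<union> B)"
      show "I \<in> (\<lambda>(I, J). I \<union> J) ` (Ind A \<times> Ind B)"
      proof (rule image_eqI)
        show "I = (\<lambda>(I, J). I \<union> J) (I \<inter> A, I \<inter> B)" using I by (auto simp: Ind_def)
        show "(I \<inter> A, I \<inter> B) \<in> Ind A \<times> Ind B" using I by (simp add: Ind_def)
      qed
    qed
  qed
  have "indep_poly_on E (A \<union> B) x = (\<Sum>I\<in>Ind (A \<union> B). x ^ card I)"
    by (simp add: indep_poly_on_def Ind_def)
  also have "\<dots> = (\<Sum>(I, J)\<in>Ind A \<times> Ind B. x ^ card (I \<union> J))"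
    unfolding img[symmetric] sum.reindex[OF inj] by (intro sum.cong) auto
  also have "\<dots> = (\<Sum>(I, J)\<in>Ind A \<times> Ind B. x ^ card I * x ^ card J)"
  proof (intro sum.cong refl, clarify)
    fix I J assume "I \<in> Ind A" "J \<in> Ind B"
    then have "I \<subseteq> A" "J \<subseteq> B" by (auto simp: Ind_def)
    then have "card (I \<union> J) = card I + card J"
      using fin disj by (intro card_Un_disjoint) (auto intro: finite_subset)
    then show "x ^ card (I \<union> J) = x ^ card I * x ^ card J" by (simp add: power_add)
  qed
  also have "\<dots> = indep_poly_on E A x * indep_poly_on E B x"
    by (simp add: sum_product sum.cartesian_product indep_poly_on_def Ind_def)
  finally show ?thesis .
qed

text \<open>
  The right-hand side sums over the independent sets of the bipartite double cover of the graph. A pair \<open>(I, J)\<close> of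
  independent sets is mapped to such a set by Zhao's bipartite swapping trick: the graph induced on \<open>I \<union> J\<close>
  is bipartite, with the bipartition cut out by \<open>I\<close>, and the two sets are exchanged inside one side \<open>D\<close> of a
  bipartition of \<open>I \<union> J\<close>. Afterwards both ends of each edge lie in the same set, and in only one of
  the two sets. If \<open>D\<close> is selected as a function of \<open>I \<union> J\<close>, which the exchange preserves, exchanging once
  more recovers \<open>(I, J)\<close>, so the map is injective.
\<close>

lemma indep_poly_on_square_le:
  fixes x :: real
  assumes V: "finite V" and sym: "\<And>u v. E u v \<Longrightarrow> E v u" and x: "x \<ge> 0"
  shows "(indep_poly_on E V x)\<^sup>2
     \<le> (\<Sum>(S, T) | S \<subseteq> V \<and> T \<subseteq> V \<and> (\<forall>u\<in>S. \<forall>v\<in>T. \<not> E u v). x ^ (card S + card T))"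
proof -
  define Ind where "Ind = {I. I \<subseteq> V \<and> (\<forall>u\<in>I. \<forall>v\<in>I. \<not> E u v)}"
  define Cross where "Cross = {(S, T). S \<subseteq> V \<and> T \<subseteq> V \<and> (\<forall>u\<in>S. \<forall>v\<in>T. \<not> E u v)}"
  define cuts where "cuts W D \<longleftrightarrow> (\<forall>u\<in>W. \<forall>v\<in>W. E u v \<longrightarrow> (u \<in> D \<longleftrightarrow> v \<notin> D))" for W D
  define cut where "cut W = (SOME D. cuts W D)" for W
  define swap where "swap D = (\<lambda>(I :: 'a set, J :: 'a set). ((I - D) \<union> (J \<inter> D), (J - D) \<union> (I \<inter> D)))" for D
  define \<phi> where "\<phi> = (\<lambda>(I, J). swap (cut (I \<union> J)) (I, J))"
  have swap_swap: "swap D (swap D p) = p" for D p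
    by (cases p) (auto simp: swap_def)
  have inj: "inj \<phi>"
  proof (rule injI)
    fix p p' assume eq: "\<phi> p = \<phi> p'"
    define un where "un = (\<lambda>(I :: 'a set, J). I \<union> J)"
    have \<phi>: "\<phi> r = swap (cut (un r)) r" for r by (cases r) (simp add: \<phi>_def un_def)
    have "un (swap D r) = un r" for D r by (cases r) (auto simp: un_def swap_def)
    then have "un p = un p'" using eq \<phi> by metis
    then show "p = p'" using eq \<phi> swap_swap by metis
  qed
  have weight: "card (fst (\<phi> (I, J))) + card (snd (\<phi> (I, J))) = card I + card J"
    if "finite I" "finite J" for I J
  proof -
    define D where "D = cut (I \<union> J)"
    have "card I = card (I - D) + card (I \<inter> D)" "card J = card (J - D) + card (J \<inter> D)"
      using that by (metis card_Diff_subset_Int card_mono Int_lower1 finite_Int le_add_diff_inverse2)+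
    moreover have "card ((I - D) \<union> (J \<inter> D)) = card (I - D) + card (J \<inter> D)"
      "card ((J - D) \<union> (I \<inter> D)) = card (J - D) + card (I \<inter> D)"
      using that by (auto intro!: card_Un_disjoint)
    ultimately show ?thesis by (simp add: \<phi>_def swap_def D_def)
  qed
  have sub: "\<phi> ` (Ind \<times> Ind) \<subseteq> Cross"
  proof (rule image_subsetI)
    fix p assume "p \<in> Ind \<times> Ind"
    then obtain I J where p: "p = (I, J)" and I: "I \<in> Ind" and J: "J \<in> Ind" by auto
    have "cuts (I \<union> J) I" using I J by (auto simp: cuts_def Ind_def)
    then have cut: "cuts (I \<union> J) (cut (I \<union> J))" unfolding cut_def by (rule someI)
    define D where "D = cut (I \<union> J)"
    define S T where "S = (I - D) \<union> (J \<inter> D)" and "T = (J - D) \<union> (I \<inter> D)"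
    have "\<not> E u v" if "u \<in> S" "v \<in> T" for u v
    proof
      assume "E u v"
      moreover have "u \<in> I \<union> J" "v \<in> I \<union> J" using that by (auto simp: S_def T_def)
      ultimately have "u \<in> D \<longleftrightarrow> v \<notin> D" using cut unfolding cuts_def D_def by blast
      then have "u \<in> I \<and> v \<in> I \<or> u \<in> J \<and> v \<in> J" using that by (auto simp: S_def T_def)
      then show False using \<open>E u v\<close> I J by (auto simp: Ind_def)
    qed
    moreover have "S \<subseteq> V" "T \<subseteq> V" using I J by (auto simp: Ind_def S_def T_def)
    ultimately show "\<phi> p \<in> Cross"
      by (simp add: p \<phi>_def swap_def Cross_def flip: D_def S_def T_def)
  qed
  have "Cross \<subseteq> Pow V \<times> Pow V" by (auto simp: Cross_def)
  then have fin: "finite Cross" by (rule finite_subset) (use V in simp)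
  have "(indep_poly_on E V x)\<^sup>2 = (\<Sum>(I, J)\<in>Ind \<times> Ind. x ^ (card I + card J))"
    by (simp add: power2_eq_square indep_poly_on_def Ind_def sum_product sum.cartesian_product power_add)
  also have "\<dots> = (\<Sum>p\<in>Ind \<times> Ind. (\<lambda>(S, T). x ^ (card S + card T)) (\<phi> p))"
  proof (intro sum.cong refl, clarify)
    fix I J assume "I \<in> Ind" "J \<in> Ind"
    then have "finite I" "finite J" using V by (auto simp: Ind_def intro: finite_subset)
    then show "x ^ (card I + card J) = (case \<phi> (I, J) of (S, T) \<Rightarrow> x ^ (card S + card T))"
      using weight[of I J] by (simp add: case_prod_beta)
  qed
  also have "\<dots> = (\<Sum>(S, T)\<in>\<phi> ` (Ind \<times> Ind). x ^ (card S + card T))"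
    using inj by (subst sum.reindex) (auto intro: inj_on_subset)
  also have "\<dots> \<le> (\<Sum>(S, T)\<in>Cross. x ^ (card S + card T))"
    using fin sub x by (intro sum_mono2) auto
  finally show ?thesis by (simp add: Cross_def)
qed

lemma cross_sum_eq_bip_indep_prob:
  fixes x :: real
  assumes V: "finite V" and x: "x > 0"
  shows "(\<Sum>(S, T) | S \<subseteq> V \<and> T \<subseteq> V \<and> (\<forall>u\<in>S. \<forall>v\<in>T. \<not> E u v). x ^ (card S + card T))
    = (1 + x) ^ (2 * card V) * bip_indep_prob (1 / (1 + x)) E V V"
proof -
  define q where "q = 1 + x"
  define N where "N S = {v \<in> V. \<exists>u\<in>S. E u v}" for S
  have q: "q > 0" using x by (simp add: q_def)
  have "{(S, T). S \<subseteq> V \<and> T \<subseteq> V \<and> (\<forall>u\<in>S. \<forall>v\<in>T. \<not> E u v)} = (SIGMA S:Pow V. Pow (V - N S))"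
    by (auto simp: N_def)
  then have "(\<Sum>(S, T) | S \<subseteq> V \<and> T \<subseteq> V \<and> (\<forall>u\<in>S. \<forall>v\<in>T. \<not> E u v). x ^ (card S + card T))
      = (\<Sum>S\<in>Pow V. \<Sum>T\<in>Pow (V - N S). x ^ (card S + card T))"
    using V by (simp add: sum.Sigma)
  also have "\<dots> = (\<Sum>S\<in>Pow V. x ^ card S * q ^ card (V - N S))"
    using V by (simp add: power_add sum_Pow_power_card q_def flip: sum_distrib_left)
  also have "\<dots> = q ^ (2 * card V) * bip_indep_prob (1 / q) E V V"
    unfolding bip_indep_prob_def sum_distrib_left
  proof (intro sum.cong refl)
    fix S assume "S \<in> Pow V"
    then have S: "S \<subseteq> V" "finite S" using V by (auto intro: finite_subset)
    have N: "N S \<subseteq> V" by (auto simp: N_def)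
    have "1 - 1 / q = x / q" using q by (simp add: q_def field_simps)
    moreover have "card V = card S + card (V - S)" "card V = card (N S) + card (V - N S)"
      using S N V by (simp_all add: card_Diff_subset card_mono finite_subset)
    then have "q ^ (2 * card V) = q ^ card S * q ^ card (V - S) * q ^ card (N S) * q ^ card (V - N S)"
      by (metis mult.assoc mult_2 power_add)
    ultimately show "x ^ card S * q ^ card (V - N S) = q ^ (2 * card V) * ((1 - 1 / q) ^ card S
        * (1 / q) ^ card (V - S) * (1 / q) ^ card {v \<in> V. \<exists>u\<in>S. E u v})"
      using q unfolding N_def[symmetric] by (simp add: power_divide)
  qed
  finally show ?thesis by (simp add: q_def)
qed

section \<open>The bound and its equality case for simple graphs\<close>

text \<open>
  For symmetric irreflexive relations without isolated points, this says that all components are complete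
  bipartite. Unlike the latter property, it passes immediately from the double cover of a graph to
  the graph.
\<close>

definition walk3_closed :: "('a \<Rightarrow> 'a \<Rightarrow> bool) \<Rightarrow> bool" where
  "walk3_closed E \<longleftrightarrow> (\<forall>a b c d. E a b \<longrightarrow> E b c \<longrightarrow> E c d \<longrightarrow> E a d)"

locale graph_without_isolated =
  fixes V :: "'a set" and E :: "'a \<Rightarrow> 'a \<Rightarrow> bool"
  assumes finite_V: "finite V"
    and adj_in_V: "E u v \<Longrightarrow> u \<in> V"
    and adj_sym: "E u v \<Longrightarrow> E v u"
    and adj_irrefl: "\<not> E v v"
    and no_isolated: "v \<in> V \<Longrightarrow> \<exists>u. E v u"
begin

abbreviation nbrs :: "'a \<Rightarrow> 'a set" where "nbrs v \<equiv> {u. E v u}"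

abbreviation dg :: "'a \<Rightarrow> nat" where "dg v \<equiv> card (nbrs v)"

lemma nbrs_subset: "nbrs v \<subseteq> V"
  using adj_in_V adj_sym by blast

lemma finite_nbrs [simp]: "finite (nbrs v)"
  using finite_subset[OF nbrs_subset finite_V] .

lemma dg_pos: "v \<in> V \<Longrightarrow> dg v > 0"
  using no_isolated[of v] by (auto simp: card_gt_0_iff)

lemma nbrs_in_eq: "nbrs_in E V v = nbrs v"
  using adj_sym adj_in_V by (auto simp: nbrs_in_def)

text \<open>
  A product over ordered pairs, so that for symmetric \<open>f\<close> every edge contributes the square of its factor.
  It is the product over the edges of the bipartite double cover.
\<close>

definition adj_prod :: "('a \<Rightarrow> 'a \<Rightarrow> real) \<Rightarrow> real" where
  "adj_prod f = (\<Prod>v\<in>V. \<Prod>u\<in>nbrs v. f u v)"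

definition edge_bound :: "real \<Rightarrow> 'a \<Rightarrow> 'a \<Rightarrow> real" where
  "edge_bound x u v = ((1 + x) ^ dg u + (1 + x) ^ dg v - 1) powr (1 / (real (dg u) * real (dg v)))"

lemma adj_prod_swap: "adj_prod (\<lambda>u v. f v u) = adj_prod f"
proof -
  have nbrs: "nbrs v = {u. u \<in> V \<and> E v u}" for v using nbrs_subset by auto
  have "adj_prod f = (\<Prod>u\<in>V. \<Prod>v | v \<in> V \<and> E v u. f u v)"
    unfolding adj_prod_def nbrs using finite_V by (intro prod.swap_restrict)
  also have "\<dots> = adj_prod (\<lambda>u v. f v u)"
    unfolding adj_prod_def using nbrs_in_eq by (intro prod.cong) (auto simp: nbrs_in_def)
  finally show ?thesis ..
qed

text \<open>
  For adjacent \<open>u\<close> and \<open>v\<close>, the passage from \<open>edge_bound\<close> to \<open>bip_density\<close> costs a factor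
  \<open>(1 + x) powr (1 / dg u + 1 / dg v)\<close>. The factors at a given vertex multiply to \<open>1 + x\<close>, once for
  each of its two copies in the double cover.
\<close>

lemma adj_prod_edge_bound:
  assumes x: "x > 0"
  shows "adj_prod (edge_bound x) = (1 + x) ^ (2 * card V) * (\<Prod>v\<in>V. vertex_bound (1 / (1 + x)) dg E V v)"
proof -
  define q where "q = 1 + x"
  have q: "q > 1" using x by (simp add: q_def)
  define r where "r u v = bip_density (1 / q) (dg u) (dg v) powr (1 / (real (dg u) * real (dg v)))" for u v
  have nv: "nbrs v \<subseteq> V" for v by (rule nbrs_subset)
  have eb: "edge_bound x u v = q powr (1 / dg u) * q powr (1 / dg v) * r u v" if "u \<in> V" "v \<in> V" for u v
  proof -
    have dens: "bip_density (1 / q) a b > 0" for a b using q by (intro bip_density_pos) auto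
    have "q ^ a + q ^ b - 1 = q ^ (a + b) * bip_density (1 / q) a b" for a b
      using q by (simp add: bip_density_def power_divide power_add field_simps)
    then have "edge_bound x u v = (q ^ (dg u + dg v)) powr (1 / (real (dg u) * real (dg v))) * r u v"
      by (simp add: edge_bound_def r_def q_def powr_mult)
    also have "(q ^ (dg u + dg v)) powr (1 / (real (dg u) * real (dg v))) = q powr (1 / dg u + 1 / dg v)"
      using q dg_pos[OF that(1)] dg_pos[OF that(2)]
      by (subst powr_of_power) (auto simp: add_divide_distrib add.commute)
    finally show ?thesis by (simp add: powr_add)
  qed
  have "adj_prod (edge_bound x) = adj_prod (\<lambda>u v. q powr (1 / dg u) * q powr (1 / dg v) * r u v)"
    unfolding adj_prod_def using nv by (intro prod.cong refl eb) auto
  also have "\<dots> = adj_prod (\<lambda>u v. q powr (1 / dg u)) * adj_prod (\<lambda>u v. q powr (1 / dg v)) * adj_prod r"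
    by (simp add: adj_prod_def prod.distrib)
  also have "adj_prod (\<lambda>u v. q powr (1 / dg u)) = adj_prod (\<lambda>u v. q powr (1 / dg v))"
    using adj_prod_swap[of "\<lambda>u v. q powr (1 / dg v)"] .
  also have "adj_prod (\<lambda>u v. q powr (1 / dg v)) = q ^ card V"
  proof -
    have "(q powr (1 / real n)) ^ n = q" if "n > 0" for n :: nat
      using q that by (simp add: powr_powr flip: powr_realpow)
    from this[OF dg_pos] show ?thesis by (simp add: adj_prod_def)
  qed
  also have "adj_prod r = (\<Prod>v\<in>V. vertex_bound (1 / q) dg E V v)"
    unfolding adj_prod_def vertex_bound_def nbrs_in_eq r_def ..
  finally show ?thesis by (simp add: q_def mult_2 power_add)
qed

text \<open>
  The bipartite theorem applied to the double cover, with \<open>A = B = V\<close> and the true degrees as nominal degrees.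
\<close>

theorem indep_poly_on_square_le_adj_prod:
  assumes x: "x > 0"
  shows "(indep_poly_on E V x)\<^sup>2 \<le> adj_prod (edge_bound x)"
    and "(indep_poly_on E V x)\<^sup>2 = adj_prod (edge_bound x) \<Longrightarrow> walk3_closed E"
proof -
  define t where "t = 1 / (1 + x)"
  have t: "0 < t" "t < 1" using x by (auto simp: t_def)
  have nbrs: "{v \<in> V. E u v} = nbrs u" for u using nbrs_subset by auto
  have le1: "(indep_poly_on E V x)\<^sup>2 \<le> (1 + x) ^ (2 * card V) * bip_indep_prob t E V V"
    using indep_poly_on_square_le[of V E x] cross_sum_eq_bip_indep_prob[of V x E] finite_V adj_sym x
    by (simp add: t_def)
  have le2: "bip_indep_prob t E V V \<le> (\<Prod>v\<in>V. vertex_bound t dg E V v)"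
    using dg_pos nbrs by (intro bip_indep_prob_le t finite_V) (auto simp: Suc_le_eq)
  have q: "(1 + x) ^ (2 * card V) > 0" using x by simp
  have le3: "(1 + x) ^ (2 * card V) * bip_indep_prob t E V V \<le> adj_prod (edge_bound x)"
    unfolding adj_prod_edge_bound[OF x] using le2 q by (simp add: t_def)
  show "(indep_poly_on E V x)\<^sup>2 \<le> adj_prod (edge_bound x)" using le1 le3 by linarith
  assume "(indep_poly_on E V x)\<^sup>2 = adj_prod (edge_bound x)"
  then have "(1 + x) ^ (2 * card V) * bip_indep_prob t E V V = adj_prod (edge_bound x)"
    using le1 le3 by linarith
  then have eq: "bip_indep_prob t E V V = (\<Prod>v\<in>V. vertex_bound t dg E V v)"
    unfolding adj_prod_edge_bound[OF x] using x by (simp add: t_def)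
  show "walk3_closed E"
    unfolding walk3_closed_def
  proof (intro allI impI)
    fix a b c d assume "E a b" "E b c" "E c d"
    then show "E a d"
      using adj_in_V[of a b] adj_in_V[of b c] adj_in_V[of c d] adj_in_V[of d c] adj_sym[of b c] adj_sym[of c d]
        dg_pos nbrs
      by (intro bip_indep_prob_eq_imp_closed[OF t finite_V finite_V _ _ eq, of a b c d])
         (simp_all add: Suc_le_eq)
  qed
qed

lemma walk3_closed_component:
  assumes closed: "walk3_closed E" and "E u v"
  shows "nbrs u \<inter> nbrs v = {}"
    and "\<And>y. y \<in> nbrs u \<Longrightarrow> nbrs y = nbrs v" and "\<And>y. y \<in> nbrs v \<Longrightarrow> nbrs y = nbrs u"
proof -
  have c: "E a d" if "E a b" "E b c" "E c d" for a b c d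
    using closed that unfolding walk3_closed_def by blast
  show "nbrs u \<inter> nbrs v = {}"
  proof (rule ccontr)
    assume "nbrs u \<inter> nbrs v \<noteq> {}"
    then obtain z where "E u z" "E v z" by auto
    then have "E z z" using c[OF adj_sym assms(2)] by simp
    then show False using adj_irrefl by simp
  qed
  have *: "nbrs y = nbrs v" if "E u v" "y \<in> nbrs u" for u v y
  proof
    have y: "E u y" "E y u" and v: "E v u" using that adj_sym by simp_all
    show "nbrs y \<subseteq> nbrs v" using c[OF v y(1)] by auto
    show "nbrs v \<subseteq> nbrs y" using c[OF y(2) that(1)] by auto
  qed
  show "\<And>y. y \<in> nbrs u \<Longrightarrow> nbrs y = nbrs v" using *[OF assms(2)] .
  show "\<And>y. y \<in> nbrs v \<Longrightarrow> nbrs y = nbrs u" using *[OF adj_sym[OF assms(2)]] .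
qed

text \<open>
  Both sides are multiplicative over components, so components can be split off one by one. A complete bipartite
  component with parts \<open>U\<close> and \<open>W\<close> has \<open>card U * card W\<close> edges, which all carry the same factor
  \<open>p powr (1 / (card U * card W))\<close>, where \<open>p\<close> is its independence polynomial.
\<close>

theorem walk3_closed_imp_eq:
  assumes closed: "walk3_closed E" and x: "x > 0"
  shows "(indep_poly_on E V x)\<^sup>2 = adj_prod (edge_bound x)"
proof -
  \<comment> \<open>Degrees are taken in the whole graph: \<open>C\<close> ranges over unions of components, where they agree.\<close>
  have "(indep_poly_on E C x)\<^sup>2 = (\<Prod>v\<in>C. \<Prod>u\<in>nbrs v. edge_bound x u v)"
    if "C \<subseteq> V" "\<And>v. v \<in> C \<Longrightarrow> nbrs v \<subseteq> C" for C
    using finite_subset[OF that(1) finite_V] that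
  proof (induction C rule: finite_psubset_induct)
    case (psubset C)
    show ?case
    proof (cases "C = {}")
      case True
      have "{I. I = {} \<and> (\<forall>u\<in>I. \<forall>v\<in>I. \<not> E u v)} = {{}}" by auto
      then show ?thesis using True by (simp add: indep_poly_on_def)
    next
      case False
      then obtain v where v: "v \<in> C" by auto
      then obtain u where uv: "E u v" using psubset.prems(1) no_isolated[of v] adj_sym by blast
      define U W where "U = nbrs u" and "W = nbrs v"
      note comp = walk3_closed_component[OF closed uv, folded U_def W_def]
      have fin: "finite U" "finite W" by (simp_all add: U_def W_def)
      have vU: "v \<in> U" and uW: "u \<in> W" using uv adj_sym by (auto simp: U_def W_def)
      have WC: "W \<subseteq> C" using psubset.prems(2)[OF v] by (simp add: W_def)
      then have UC: "U \<subseteq> C" using psubset.prems(2)[of u] uW by (auto simp: U_def)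
      define C' where "C' = C - (U \<union> W)"
      have C: "C = (U \<union> W) \<union> C'" "(U \<union> W) \<inter> C' = {}" "C' \<subset> C"
        using UC WC vU by (auto simp: C'_def)
      have finC': "finite C'" using psubset.hyps by (simp add: C'_def)
      have no_edge: "\<not> E y z \<and> \<not> E z y" if "y \<in> U \<union> W" "z \<in> C'" for y z
      proof -
        have "\<not> E y z" using that comp(2)[of y] comp(3)[of y] by (auto simp: C'_def)
        then show ?thesis using adj_sym[of z y] by blast
      qed
      have IH: "(indep_poly_on E C' x)\<^sup>2 = (\<Prod>v\<in>C'. \<Prod>u\<in>nbrs v. edge_bound x u v)"
      proof (rule psubset.IH[OF C(3)])
        show "C' \<subseteq> V" using psubset.prems by (auto simp: C'_def)
        fix z assume z: "z \<in> C'"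
        show "nbrs z \<subseteq> C'"
        proof
          fix y assume "y \<in> nbrs z"
          then show "y \<in> C'"
            using no_edge[OF _ z, of y] psubset.prems(2)[of z] z unfolding C'_def by blast
        qed
      qed
      define p where "p = (1 + x) ^ card U + (1 + x) ^ card W - 1"
      have p: "p > 0" 
      proof -
        have "1 \<le> (1 + x) ^ card U" "1 \<le> (1 + x) ^ card W" using x by (simp_all add: one_le_power)
        then show ?thesis unfolding p_def by linarith
      qed
      have poly: "indep_poly_on E (U \<union> W) x = p"
        unfolding p_def
      proof (rule indep_poly_on_complete_bipartite[OF fin comp(1)])
        fix y z
        show "E y z" if "y \<in> U" "z \<in> W" using comp(2)[of y] that by auto
        show "\<not> E y z" if "y \<in> U" "z \<in> U" using comp(1) comp(2)[of y] that by auto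
        show "\<not> E y z" if "y \<in> W" "z \<in> W" using comp(1) comp(3)[of y] that by auto
      qed
      have card_pos: "card U > 0" "card W > 0" using fin vU uW by (auto simp: card_gt_0_iff)
      define P where "P = p powr (1 / (real (card U) * real (card W)))"
      have "(\<Prod>v\<in>U. \<Prod>u\<in>nbrs v. edge_bound x u v) = (\<Prod>v\<in>U. \<Prod>u\<in>W. P)"
        using comp(2,3) by (intro prod.cong refl)
          (auto simp: edge_bound_def P_def p_def add.commute mult.commute)
      moreover have "(\<Prod>v\<in>W. \<Prod>u\<in>nbrs v. edge_bound x u v) = (\<Prod>v\<in>W. \<Prod>u\<in>U. P)"
        using comp(2,3) by (intro prod.cong refl)
          (auto simp: edge_bound_def P_def p_def add.commute mult.commute)
      moreover have "P ^ (card U * card W) = p"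
        using p card_pos by (simp add: P_def powr_powr flip: powr_realpow)
      ultimately have "(\<Prod>v\<in>U. \<Prod>u\<in>nbrs v. edge_bound x u v) = p"
        "(\<Prod>v\<in>W. \<Prod>u\<in>nbrs v. edge_bound x u v) = p"
        by (simp_all add: mult.commute flip: power_mult)
      then have "(\<Prod>v\<in>U \<union> W. \<Prod>u\<in>nbrs v. edge_bound x u v) = p\<^sup>2"
        using fin comp(1) by (simp add: prod.union_disjoint power2_eq_square)
      then have "(\<Prod>v\<in>C. \<Prod>u\<in>nbrs v. edge_bound x u v) = p\<^sup>2 * (indep_poly_on E C' x)\<^sup>2"
        unfolding C(1) IH using fin finC' C(2) by (subst prod.union_disjoint) auto
      moreover have "indep_poly_on E C x = p * indep_poly_on E C' x"
        unfolding poly[symmetric] C(1) using fin finC' C(2) no_edge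
        by (intro indep_poly_on_Un) auto
      ultimately show ?thesis by (simp add: power_mult_distrib)
    qed
  qed
  from this[of V] show ?thesis using nbrs_subset by (simp add: adj_prod_def)
qed

end

section \<open>Disjoint unions of complete bipartite graphs\<close>

lemma indep_poly_eq_on: "indep_poly G x = indep_poly_on (\<lambda>u v. u \<rightarrow>\<^bsub>G\<^esub> v) (verts G) x"
  by (simp add: indep_poly_def indep_sets_def indep_poly_on_def)

lemma indep_poly_complete_bipartite:
  "indep_poly (complete_bipartite a b) x = (1 + x) ^ a + (1 + x) ^ b - 1"
proof -
  let ?K = "complete_bipartite a b" and ?U = "Inl ` {..<a} :: (nat + nat) set"
    and ?W = "Inr ` {..<b} :: (nat + nat) set"
  have "verts ?K = ?U \<union> ?W" and ends: "arcs_ends ?K = ?U \<times> ?W \<union> ?W \<times> ?U"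
    by (simp_all add: complete_bipartite_def Let_def)
  then have "indep_poly ?K x = indep_poly_on (\<lambda>u v. u \<rightarrow>\<^bsub>?K\<^esub> v) (?U \<union> ?W) x"
    by (simp add: indep_poly_eq_on)
  also have "\<dots> = (1 + x) ^ card ?U + (1 + x) ^ card ?W - 1"
    by (rule indep_poly_on_complete_bipartite) (auto simp: ends)
  finally show ?thesis by (simp add: card_image)
qed

context graph
begin

lemma out_degree_eq_card_nbrs: "out_degree G v = card {u. v \<rightarrow>\<^bsub>G\<^esub> u}"
proof -
  have "inj_on (head G) (out_arcs G v)"
    by (rule inj_onI) (auto simp: out_arcs_def arc_to_ends_def intro!: no_multi_arcs)
  moreover have "head G ` out_arcs G v = {u. v \<rightarrow>\<^bsub>G\<^esub> u}"
    by (auto simp: out_arcs_def arcs_ends_conv)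
  ultimately show ?thesis
    unfolding out_degree_def by (metis card_image)
qed

lemma graph_without_isolated_dominates:
  assumes "no_isolated_verts G"
  shows "graph_without_isolated (verts G) (\<lambda>u v. u \<rightarrow>\<^bsub>G\<^esub> v)"
proof
  show "\<exists>u. v \<rightarrow>\<^bsub>G\<^esub> u" if "v \<in> verts G" for v
  proof (rule ccontr)
    assume "\<nexists>u. v \<rightarrow>\<^bsub>G\<^esub> u"
    then have "{u. v \<rightarrow>\<^bsub>G\<^esub> u} = {}" by simp
    then have "out_degree G v = 0" by (simp only: out_degree_eq_card_nbrs card.empty)
    then show False using assms that by (auto simp: no_isolated_verts_def)
  qed
qed (use adj_in_verts graph_symmetric adj_not_same in auto)

text \<open>
  Each edge is the image of exactly two arcs, on which \<open>f\<close> takes the same value.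
\<close>

lemma prod_edges_square:
  assumes sym: "\<And>u v. f u v = f v u"
  shows "(prod_edges G f)\<^sup>2 = (\<Prod>v\<in>verts G. \<Prod>u | v \<rightarrow>\<^bsub>G\<^esub> u. f u v)"
proof -
  define h where "h e = (let p = (SOME p. e = {fst p, snd p}) in f (fst p) (snd p))" for e
  have h: "h {u, v} = f u v" for u v
    unfolding h_def by (rule prod_edges_factor) (rule sym)
  have fin: "finite (arcs_ends G)" by (simp add: arcs_ends_def)
  define \<epsilon> where "\<epsilon> = (\<lambda>(u, v). {u, v} :: 'a set)"
  have edges: "edges G = \<epsilon> ` arcs_ends G" by (auto simp: edges_def \<epsilon>_def)
  have fibre: "(\<Prod>p | p \<in> arcs_ends G \<and> \<epsilon> p = e. f (snd p) (fst p)) = (h e)\<^sup>2" if e_edge: "e \<in> edges G" for e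
  proof -
    obtain u v where e: "e = {u, v}" and uv: "u \<rightarrow>\<^bsub>G\<^esub> v"
      using e_edge unfolding edges_def by blast
    have "{p. p \<in> arcs_ends G \<and> \<epsilon> p = e} = {(u, v), (v, u)}"
      using uv graph_symmetric by (auto simp: e \<epsilon>_def doubleton_eq_iff)
    moreover have "u \<noteq> v" using uv adj_not_same by auto
    ultimately show ?thesis using sym[of u v] h[of u v] by (simp add: e power2_eq_square)
  qed
  have "(prod_edges G f)\<^sup>2 = (\<Prod>e\<in>edges G. (h e)\<^sup>2)"
    by (simp add: prod_edges_def h_def prod_power_distrib)
  also have "\<dots> = (\<Prod>p\<in>arcs_ends G. f (snd p) (fst p))"
    using fin by (subst prod.group[of _ "edges G" \<epsilon>, symmetric]) (auto simp: fibre edges)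
  also have "arcs_ends G = (SIGMA v:verts G. {u. v \<rightarrow>\<^bsub>G\<^esub> u})"
    using adj_in_verts by auto
  also have "(\<Prod>p\<in>\<dots>. f (snd p) (fst p)) = (\<Prod>v\<in>verts G. \<Prod>u | v \<rightarrow>\<^bsub>G\<^esub> u. f u v)"
  proof -
    have "finite {u. v \<rightarrow>\<^bsub>G\<^esub> u}" for v
      by (rule finite_subset[OF _ finite_verts]) (use adj_in_verts in auto)
    then show ?thesis by (subst prod.Sigma) (auto simp: case_prod_beta)
  qed
  finally show ?thesis .
qed

text \<open>
  A walk stays in one component, where a walk of length three has its ends in different parts.
\<close>

lemma disjoint_union_of_complete_bipartite_imp_walk3_closed:
  assumes "disjoint_union_of_complete_bipartite G"
  shows "walk3_closed (\<lambda>u v. u \<rightarrow>\<^bsub>G\<^esub> v)"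
proof -
  obtain Hs where sub: "\<And>H. H \<in> Hs \<Longrightarrow> subgraph H G"
    and disj: "\<And>H H'. H \<in> Hs \<Longrightarrow> H' \<in> Hs \<Longrightarrow> H \<noteq> H' \<Longrightarrow> verts H \<inter> verts H' = {}"
    and G: "G = Union Hs" and K: "\<And>H. H \<in> Hs \<Longrightarrow> \<exists>a b. K\<^bsub>a,b\<^esub> H"
    using assms unfolding disjoint_union_of_complete_bipartite_def disjoint_union_of_def by metis
  have arc_in: "\<exists>H\<in>Hs. u \<rightarrow>\<^bsub>H\<^esub> v" if "u \<rightarrow>\<^bsub>G\<^esub> v" for u v
  proof -
    obtain e where e: "e \<in> arcs G" "tail G e = u" "head G e = v" using \<open>u \<rightarrow>\<^bsub>G\<^esub> v\<close> by (rule reachableE)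
    have "arcs G = (\<Union>H\<in>Hs. arcs H)" using arg_cong[OF G, of arcs] by (simp add: Union_def)
    then obtain H where H: "H \<in> Hs" "e \<in> arcs H" using e by auto
    have "compatible G H" using sub[OF H(1)] by (simp add: subgraph_def)
    then have "u \<rightarrow>\<^bsub>H\<^esub> v"
      using H(2) e by (auto simp: arcs_ends_conv compatible_tail compatible_head)
    then show ?thesis using H by auto
  qed
  have ends_in: "u \<in> verts H" "v \<in> verts H" if "H \<in> Hs" "u \<rightarrow>\<^bsub>H\<^esub> v" for H u v
  proof -
    have "wf_digraph H" using sub[OF that(1)] by (simp add: subgraph_def)
    then show "u \<in> verts H" "v \<in> verts H" using that(2) by (auto intro: wf_digraph.adj_in_verts)
  qed
  show ?thesis
    unfolding walk3_closed_def
  proof (intro allI impI)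
    fix a b c d assume "a \<rightarrow>\<^bsub>G\<^esub> b" "b \<rightarrow>\<^bsub>G\<^esub> c" "c \<rightarrow>\<^bsub>G\<^esub> d"
    then obtain H H' H'' where H: "H \<in> Hs" "a \<rightarrow>\<^bsub>H\<^esub> b" and H': "H' \<in> Hs" "b \<rightarrow>\<^bsub>H'\<^esub> c"
      and H'': "H'' \<in> Hs" "c \<rightarrow>\<^bsub>H''\<^esub> d"
      using arc_in by meson
    have "H = H'" using disj[of H H'] ends_in[OF H] ends_in[OF H'] H H' by auto
    moreover have "H' = H''" using disj[of H' H''] ends_in[OF H'] ends_in[OF H''] H' H'' by auto
    ultimately have walk: "a \<rightarrow>\<^bsub>H\<^esub> b" "b \<rightarrow>\<^bsub>H\<^esub> c" "c \<rightarrow>\<^bsub>H\<^esub> d" using H H' H'' by auto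
    obtain U W where UW: "U \<inter> W = {}" "arcs_ends H = U \<times> W \<union> W \<times> U"
      using K[OF H(1)] unfolding complete_bipartite_digraph_def by metis
    have "a \<rightarrow>\<^bsub>H\<^esub> d" using walk UW(1) unfolding UW(2) by auto
    then show "a \<rightarrow>\<^bsub>G\<^esub> d" using arcs_ends_mono[OF sub[OF H(1)]] by auto
  qed
qed

text \<open>
  The component of an edge \<open>uv\<close> is induced by the neighbourhoods of \<open>u\<close> and \<open>v\<close>, which are the two parts of a complete
  bipartite graph. It can be recovered from each of its vertices \<open>z\<close>, as the set of
  ends of the walks of length one or two that start at \<open>z\<close>; hence different components are disjoint.
\<close>

lemma walk3_closed_imp_disjoint_union_of_complete_bipartite:
  assumes closed: "walk3_closed (\<lambda>u v. u \<rightarrow>\<^bsub>G\<^esub> v)" and no_iso: "no_isolated_verts G"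
  shows "disjoint_union_of_complete_bipartite G"
proof -
  interpret graph_without_isolated "verts G" "\<lambda>u v. u \<rightarrow>\<^bsub>G\<^esub> v" by (rule graph_without_isolated_dominates[OF no_iso])
  define Hs where "Hs = {G \<restriction> (nbrs u \<union> nbrs v) |u v. u \<rightarrow>\<^bsub>G\<^esub> v}"
  note comp = walk3_closed_component[OF closed]
  have induced: "induced_subgraph (G \<restriction> (nbrs u \<union> nbrs v)) G" for u v
    using nbrs_subset by (intro induced_induce) auto
  have same: "nbrs u \<union> nbrs v = nbrs z \<union> (\<Union>y\<in>nbrs z. nbrs y)"
    if uv: "u \<rightarrow>\<^bsub>G\<^esub> v" and z: "z \<in> nbrs u \<union> nbrs v" for u v z
  proof -
    have "(\<Union>y\<in>nbrs u. nbrs y) = (\<Union>y\<in>nbrs u. nbrs v)" "(\<Union>y\<in>nbrs v. nbrs y) = (\<Union>y\<in>nbrs v. nbrs u)"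
      using comp(2,3)[OF uv] by auto
    moreover have "nbrs u \<noteq> {}" "nbrs v \<noteq> {}" using uv graph_symmetric by auto
    ultimately have "(\<Union>y\<in>nbrs u. nbrs y) = nbrs v" "(\<Union>y\<in>nbrs v. nbrs y) = nbrs u"
      by (simp_all only: UN_constant if_False)
    then show ?thesis using z comp(2,3)[OF uv, of z] by auto
  qed
  have disj: "verts H \<inter> verts H' = {}" if HH': "H \<in> Hs" "H' \<in> Hs" "H \<noteq> H'" for H H'
  proof (rule ccontr)
    obtain u v u' v' where uv: "u \<rightarrow>\<^bsub>G\<^esub> v" "H = G \<restriction> (nbrs u \<union> nbrs v)"
      and uv': "u' \<rightarrow>\<^bsub>G\<^esub> v'" "H' = G \<restriction> (nbrs u' \<union> nbrs v')"
      using HH' unfolding Hs_def by blast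
    assume "verts H \<inter> verts H' \<noteq> {}"
    then obtain z where "z \<in> nbrs u \<union> nbrs v" "z \<in> nbrs u' \<union> nbrs v'" by (auto simp: uv(2) uv'(2))
    then have "nbrs u \<union> nbrs v = nbrs u' \<union> nbrs v'"
      using same[OF uv(1)] same[OF uv'(1)] by simp
    then show False using HH' uv uv' by simp
  qed
  have cover: "\<exists>H\<in>Hs. tail G e \<in> verts H \<and> e \<in> arcs H" if "e \<in> arcs G" for e
  proof -
    have uv: "tail G e \<rightarrow>\<^bsub>G\<^esub> head G e" using that by (auto simp: arcs_ends_conv)
    then have "head G e \<rightarrow>\<^bsub>G\<^esub> tail G e" by (rule graph_symmetric)
    then show ?thesis using uv that unfolding Hs_def
      by (intro bexI[of _ "G \<restriction> (nbrs (tail G e) \<union> nbrs (head G e))"]) auto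
  qed
  have "disjoint_union_of G Hs"
    unfolding disjoint_union_of_def
  proof (intro conjI ballI impI)
    show "subgraph H G" if "H \<in> Hs" for H
      using that induced unfolding Hs_def by auto
    then have sub: "verts H \<subseteq> verts G" "arcs H \<subseteq> arcs G" if "H \<in> Hs" for H
      using that unfolding subgraph_def by auto
    have "verts G = (\<Union>H\<in>Hs. verts H)"
    proof
      show "verts G \<subseteq> (\<Union>H\<in>Hs. verts H)"
      proof
        fix v assume "v \<in> verts G"
        then obtain u where "v \<rightarrow>\<^bsub>G\<^esub> u" using no_isolated by auto
        then obtain e where "e \<in> arcs G" "tail G e = v" by (rule reachableE)
        then show "v \<in> (\<Union>H\<in>Hs. verts H)" using cover[of e] by auto
      qed
    qed (use sub in auto)
    moreover have "arcs G = (\<Union>H\<in>Hs. arcs H)"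
      using sub cover by fastforce
    ultimately show "G = Union Hs" by (simp add: Union_def)
  qed (use disj in auto)
  moreover have "\<exists>a b. 1 \<le> a \<and> 1 \<le> b \<and> K\<^bsub>a,b\<^esub> H" if H: "H \<in> Hs" for H
  proof -
    obtain u v where uv: "u \<rightarrow>\<^bsub>G\<^esub> v" and H: "H = G \<restriction> (nbrs u \<union> nbrs v)"
      using H unfolding Hs_def by auto
    have "arcs_ends H = {(x, y). x \<rightarrow>\<^bsub>G\<^esub> y \<and> x \<in> nbrs u \<union> nbrs v \<and> y \<in> nbrs u \<union> nbrs v}"
      by (auto simp: H arcs_ends_conv)
    also have "\<dots> = nbrs u \<times> nbrs v \<union> nbrs v \<times> nbrs u"
    proof -
      have "x \<rightarrow>\<^bsub>G\<^esub> y \<longleftrightarrow> v \<rightarrow>\<^bsub>G\<^esub> y" if "u \<rightarrow>\<^bsub>G\<^esub> x" for x y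
        using comp(2)[OF uv, of x] that by auto
      moreover have "x \<rightarrow>\<^bsub>G\<^esub> y \<longleftrightarrow> u \<rightarrow>\<^bsub>G\<^esub> y" if "v \<rightarrow>\<^bsub>G\<^esub> x" for x y
        using comp(3)[OF uv, of x] that by auto
      ultimately show ?thesis by blast
    qed
    finally have ends: "arcs_ends H = nbrs u \<times> nbrs v \<union> nbrs v \<times> nbrs u" .
    have "digraph H" using induced unfolding H by (intro digraphI_induced)
    moreover have "symmetric H"
      using induced unfolding H by (rule induced_graph_imp_symmetric[OF sym_arcs])
    ultimately have "graph H" by (rule digraph.graphI)
    moreover have "verts H = nbrs u \<union> nbrs v" by (simp add: H)
    ultimately have "K\<^bsub>dg u,dg v\<^esub> H"
      unfolding complete_bipartite_digraph_def using ends comp(1)[OF uv] by blast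
    moreover have "1 \<le> dg u" "1 \<le> dg v"
      using dg_pos adj_in_verts[OF uv] by (simp_all add: Suc_le_eq)
    ultimately show ?thesis by blast
  qed
  ultimately show ?thesis unfolding disjoint_union_of_complete_bipartite_def by blast
qed

end

theorem theorem1p5:
  fixes G :: "('a, 'b) pre_digraph" and lam :: real
  assumes "graph G" and "no_isolated_verts G" and "lam > 0"
  shows "indep_poly G lam \<le>
           prod_edges G (\<lambda>u v. indep_poly (complete_bipartite (deg G v) (deg G u)) lam
                                  powr (1 / (real (deg G u) * real (deg G v))))
       \<and> prod_edges G (\<lambda>u v. indep_poly (complete_bipartite (deg G v) (deg G u)) lam
                                  powr (1 / (real (deg G u) * real (deg G v))))
         = prod_edges G (\<lambda>u v. ((1 + lam) ^ deg G u + (1 + lam) ^ deg G v - 1)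
                                  powr (1 / (real (deg G u) * real (deg G v))))
       \<and> (indep_poly G lam =
           prod_edges G (\<lambda>u v. indep_poly (complete_bipartite (deg G v) (deg G u)) lam
                                  powr (1 / (real (deg G u) * real (deg G v))))
          \<longleftrightarrow> disjoint_union_of_complete_bipartite G)"
proof -
  interpret graph G by fact
  interpret S: graph_without_isolated "verts G" "\<lambda>u v. u \<rightarrow>\<^bsub>G\<^esub> v" by (rule graph_without_isolated_dominates) fact
  define F where "F u v = ((1 + lam) ^ deg G u + (1 + lam) ^ deg G v - 1)
                                  powr (1 / (real (deg G u) * real (deg G v)))" for u v
  have F_eq: "(\<lambda>u v. indep_poly (complete_bipartite (deg G v) (deg G u)) lam
                                  powr (1 / (real (deg G u) * real (deg G v)))) = F"
    by (simp add: fun_eq_iff F_def indep_poly_complete_bipartite add.commute)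
  have F_edge: "F = S.edge_bound lam"
    by (simp add: fun_eq_iff F_def S.edge_bound_def out_degree_eq_card_nbrs)
  have "F u v = F v u" for u v by (simp add: F_def add.commute mult.commute)
  then have square: "(prod_edges G F)\<^sup>2 = S.adj_prod (S.edge_bound lam)"
    unfolding F_edge[symmetric] S.adj_prod_def by (rule prod_edges_square)
  have P: "indep_poly G lam = indep_poly_on (\<lambda>u v. u \<rightarrow>\<^bsub>G\<^esub> v) (verts G) lam" by (rule indep_poly_eq_on)
  have nonneg: "indep_poly G lam \<ge> 0"
    unfolding indep_poly_def using \<open>lam > 0\<close> by (intro sum_nonneg) auto
  have F_nonneg: "prod_edges G F \<ge> 0"
    unfolding prod_edges_def Let_def by (intro prod_nonneg) (simp add: F_def)
  note main = S.indep_poly_on_square_le_adj_prod[OF \<open>lam > 0\<close>, folded P square]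
  have "indep_poly G lam \<le> prod_edges G F"
    using main(1) F_nonneg by (rule power2_le_imp_le)
  moreover have "indep_poly G lam = prod_edges G F \<longleftrightarrow> disjoint_union_of_complete_bipartite G"
  proof
    assume "indep_poly G lam = prod_edges G F"
    then show "disjoint_union_of_complete_bipartite G"
      using main(2) \<open>no_isolated_verts G\<close>
      by (intro walk3_closed_imp_disjoint_union_of_complete_bipartite) simp_all
  next
    assume "disjoint_union_of_complete_bipartite G"
    then have "(indep_poly G lam)\<^sup>2 = (prod_edges G F)\<^sup>2"
      unfolding P square
      by (intro S.walk3_closed_imp_eq disjoint_union_of_complete_bipartite_imp_walk3_closed \<open>lam > 0\<close>)
    then show "indep_poly G lam = prod_edges G F"
      using nonneg F_nonneg by (rule power2_eq_imp_eq)
  qed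
  ultimately show ?thesis unfolding F_eq F_def[symmetric] by simp
qed

end
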